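(* Let $n\ge 2$, let $s_1,\dots,s_{n+2}$ be constants, and let $\phi,\phi_1,\phi_2$ be three linearly independent solutions, polynomial of degree $n$ in $\zeta$ with coefficients depending on $u_1,\dots,u_n$, of the linear system (L) of the context. Let $F,G,H$ be functions of $(\zeta,u_1,\dots,u_n)$ satisfying, for $i=1,\dots,n$, $$F_\zeta=\frac{\phi(\zeta)}{W(\zeta)},\quad F_{u_i}=-\frac{\phi(u_i)}{D_i}\frac{P_i(\zeta)}{W(\zeta)};\qquad G_\zeta=\frac{\phi_1(\zeta)}{W(\zeta)},\quad G_{u_i}=-\frac{\phi_1(u_i)}{D_i}\frac{P_i(\zeta)}{W(\zeta)};\qquad H_\zeta=\frac{\phi_2(\zeta)}{W(\zeta)},\quad H_{u_i}=-\frac{\phi_2(u_i)}{D_i}\frac{P_i(\zeta)}{W(\zeta)}.$$ Then the system $$\Psi_y=F(\zeta,u_1,\dots,u_n),\qquad \Psi_t=G(\zeta,u_1,\dots,u_n),\qquad \Psi_x=H(\zeta,u_1,\dots,u_n)$$ defines a pseudopotential for some quasilinear system of $m=n$ linearly independent equations of the form $$\sum_{j=1}^n a_{ij}(\mathbf u)u_{jy}+\sum_{j=1}^n b_{ij}(\mathbf u)u_{jt}+\sum_{j=1}^n c_{ij}(\mathbf u)u_{jx}=0,\qquad i=1,\dots,m;$$ that is, the compatibility conditions of the system for $\Psi$ are equivalent to such a system.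
   Context: Everything is local and analytic, on a domain where $u_1,\dots,u_n$ are pairwise distinct and different from $0,1$, and $\zeta\ne 0,1,u_1,\dots,u_n$ (with fixed branches of the power functions). Notation: $$W(\zeta)=\zeta^{s_1}(\zeta-1)^{s_2}\prod_{m=1}^n(\zeta-u_m)^{s_{m+2}},\quad P_i(\zeta)=\zeta(\zeta-1)\prod_{m\ne i}(\zeta-u_m),\quad D_i=P_i(u_i)=u_i(u_i-1)\prod_{m\neq i}(u_i-u_m).$$ The linear system (L) for a polynomial $\phi(\zeta)=\alpha_0(\mathbf u)+\alpha_1(\mathbf u)\zeta+\dots+\alpha_n(\mathbf u)\zeta^n$ is $$\phi_{u_i}(\zeta)=\phi(u_i)\frac{P_i(\zeta)}{D_i}\left(\frac{s_1-1}{\zeta}+\frac{s_2-1}{\zeta-1}+\frac{s_{i+2}}{\zeta-u_i}+\sum_{m\ne i}\frac{s_{m+2}-1}{\zeta-u_m}\right)-\frac{s_{i+2}}{\zeta-u_i}\phi(\zeta),\quad i=1,\dots,n,$$ where $\phi_{u_i}(\zeta)=\sum_k \alpha_{k,u_i}\zeta^k$. Its right-hand side is a polynomial of degree at most $n$ in $\zeta$, so (L) is a linear system of PDEs for $\alpha_0,\dots,\alpha_n$; it is in involution and has an $(n+1)$-dimensional space of solutions (linear independence is over constants). (L) is the condition for the equations defining $F$ (resp. $G$, $H$) to be in involution. Compatibility conditions. For a system $\Psi_y=F(\zeta,\mathbf u)$, $\Psi_t=G(\zeta,\mathbf u)$, $\Psi_x=H(\zeta,\mathbf u)$, where $\zeta$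 is a parameter to be eliminated (expressed through $\Psi_y$ from the first equation) and $\mathbf u=\mathbf u(x,y,t)$, the compatibility condition is $$\sum_{i=1}^n(H_{\zeta}G_{u_i}-G_{\zeta}H_{u_i})u_{iy}+\sum_{i=1}^n(F_{\zeta}H_{u_i}-H_{\zeta}F_{u_i})u_{it}+\sum_{i=1}^n(G_{\zeta}F_{u_i}-F_{\zeta}G_{u_i})u_{ix}=0,$$ required to hold identically in $\zeta$. Such a system is a pseudopotential for a quasilinear system for $\mathbf u$ if its compatibility condition is equivalent to that quasilinear system.
   Formalization: Added hypothesis: φ, φ_1, φ_2 do not all vanish identically at ζ=0 if s_1=1, at ζ=1 if s_2=1, at ζ=u_j if s_{j+2}=1, nor all have degree <n if the s_k sum to n+1; otherwise (e.g. n=3, s_1=1) fewer than n equations result. Linear independence is at generic u. *)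

theory Defs
  imports "HOL-Analysis.Analysis" "HOL-Computational_Algebra.Polynomial"
begin

text \<open>
  The index set \<open>{1,\<dots>,n}\<close> is a finite type \<open>'n\<close> with \<open>CARD('n) = n\<close>.  Of the constants
  \<open>s_1, \<dots>, s_{n+2}\<close>, the first two are \<open>s1\<close>, \<open>s2\<close> and \<open>s_{m+2}\<close> is \<open>s m\<close> for \<open>m :: 'n\<close>.
\<close>

subsection \<open>Analytic functions of several complex variables\<close>

text \<open>The type \<open>complex ^ 'k\<close> is only a real vector space in the library, so complex linearity of the
  Frechet derivative is spelled out.\<close>

definition holomorphic_vec :: "(complex ^ 'k \<Rightarrow> complex) \<Rightarrow> (complex ^ 'k) set \<Rightarrow> bool" where
  "holomorphic_vec f X \<longleftrightarrow>
     (\<forall>p\<in>X. \<exists>d :: complex ^ 'k. (f has_derivative (\<lambda>h. \<Sum>i\<in>UNIV. d $ i * h $ i)) (at p))"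

definition holomorphic_pair ::
  "(complex \<Rightarrow> complex ^ 'k \<Rightarrow> complex) \<Rightarrow> (complex \<times> (complex ^ 'k)) set \<Rightarrow> bool" where
  "holomorphic_pair F X \<longleftrightarrow>
     (\<forall>p\<in>X. \<exists>(c :: complex) (d :: complex ^ 'k).
        ((\<lambda>q. F (fst q) (snd q)) has_derivative
           (\<lambda>h. c * fst h + (\<Sum>i\<in>UNIV. d $ i * snd h $ i))) (at p))"

definition partial_deriv :: "'k \<Rightarrow> (complex ^ 'k \<Rightarrow> complex) \<Rightarrow> complex ^ 'k \<Rightarrow> complex" where
  "partial_deriv i f p = deriv (\<lambda>t. f (\<chi> j. if j = i then t else p $ j)) (p $ i)"

subsection \<open>The functions \<open>W\<close>, \<open>P_i\<close>, \<open>D_i\<close> and the linear system for \<open>\<phi>\<close>\<close>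

definition admissible_domain :: "(complex \<times> (complex ^ 'n)) set \<Rightarrow> bool" where
  "admissible_domain \<Omega> \<longleftrightarrow> open \<Omega> \<and> connected \<Omega> \<and>
     (\<forall>(\<zeta>, u)\<in>\<Omega>. inj (\<lambda>i. u $ i) \<and> (\<forall>i. u $ i \<noteq> 0 \<and> u $ i \<noteq> 1) \<and>
        \<zeta> \<noteq> 0 \<and> \<zeta> \<noteq> 1 \<and> (\<forall>i. \<zeta> \<noteq> u $ i))"

text \<open>Fixed branches of the power functions: \<open>l0\<close>, \<open>l1\<close>, \<open>l m\<close> are branches on \<open>\<Omega>\<close> of the
  logarithms of \<open>\<zeta>\<close>, \<open>\<zeta> - 1\<close>, \<open>\<zeta> - u_m\<close>.\<close>

definition W_branch ::
  "complex \<Rightarrow> complex \<Rightarrow> ('n::finite \<Rightarrow> complex) \<Rightarrow> (complex \<times> (complex ^ 'n)) set \<Rightarrow>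
   (complex \<Rightarrow> complex ^ 'n \<Rightarrow> complex) \<Rightarrow> bool" where
  "W_branch s1 s2 s \<Omega> W \<longleftrightarrow>
     (\<exists>(l0 :: complex \<times> (complex ^ 'n) \<Rightarrow> complex) l1 (l :: 'n \<Rightarrow> complex \<times> (complex ^ 'n) \<Rightarrow> complex).
        continuous_on \<Omega> l0 \<and> continuous_on \<Omega> l1 \<and> (\<forall>m. continuous_on \<Omega> (l m)) \<and>
        (\<forall>(\<zeta>, u)\<in>\<Omega>.
           exp (l0 (\<zeta>, u)) = \<zeta> \<and> exp (l1 (\<zeta>, u)) = \<zeta> - 1 \<and>
           (\<forall>m. exp (l m (\<zeta>, u)) = \<zeta> - u $ m) \<and>
           W \<zeta> u = exp (s1 * l0 (\<zeta>, u)) * exp (s2 * l1 (\<zeta>, u)) *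
                   (\<Prod>m\<in>UNIV. exp (s m * l m (\<zeta>, u)))))"

definition P :: "'n::finite \<Rightarrow> complex \<Rightarrow> complex ^ 'n \<Rightarrow> complex" where
  "P i \<zeta> u = \<zeta> * (\<zeta> - 1) * (\<Prod>m\<in>UNIV - {i}. (\<zeta> - u $ m))"

definition D :: "'n::finite \<Rightarrow> complex ^ 'n \<Rightarrow> complex" where
  "D i u = P i (u $ i) u"

text \<open>Solutions of degree at most \<open>n\<close> in \<open>\<zeta>\<close>, with coefficients analytic on \<open>U\<close>.  Both sides of the
  equation are polynomials in \<open>\<zeta>\<close>; as written, it avoids the removable singularities of the
  right-hand side.\<close>

definition solves_L ::
  "complex \<Rightarrow> complex \<Rightarrow> ('n::finite \<Rightarrow> complex) \<Rightarrow> (complex ^ 'n) set \<Rightarrow>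
   (complex ^ 'n \<Rightarrow> complex poly) \<Rightarrow> bool" where
  "solves_L s1 s2 s U \<phi> \<longleftrightarrow>
     (\<forall>u\<in>U. degree (\<phi> u) \<le> CARD('n)) \<and>
     (\<forall>k. holomorphic_vec (\<lambda>u. coeff (\<phi> u) k) U) \<and>
     (\<forall>u\<in>U. \<forall>i \<zeta>. \<zeta> \<noteq> 0 \<and> \<zeta> \<noteq> 1 \<and> (\<forall>m. \<zeta> \<noteq> u $ m) \<longrightarrow>
        (\<Sum>k\<le>CARD('n). partial_deriv i (\<lambda>v. coeff (\<phi> v) k) u * \<zeta> ^ k) =
          poly (\<phi> u) (u $ i) * (P i \<zeta> u / D i u) *
            ((s1 - 1) / \<zeta> + (s2 - 1) / (\<zeta> - 1) + s i / (\<zeta> - u $ i) +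
             (\<Sum>m\<in>UNIV - {i}. (s m - 1) / (\<zeta> - u $ m)))
          - s i / (\<zeta> - u $ i) * poly (\<phi> u) \<zeta>)"

definition lin_indep3 ::
  "(complex ^ 'n) set \<Rightarrow> (complex ^ 'n \<Rightarrow> complex poly) \<Rightarrow> (complex ^ 'n \<Rightarrow> complex poly) \<Rightarrow>
   (complex ^ 'n \<Rightarrow> complex poly) \<Rightarrow> bool" where
  "lin_indep3 U \<phi> \<phi>1 \<phi>2 \<longleftrightarrow>
     (\<forall>c c1 c2 :: complex.
        (\<forall>u\<in>U. smult c (\<phi> u) + smult c1 (\<phi>1 u) + smult c2 (\<phi>2 u) = 0) \<longrightarrow>
        c = 0 \<and> c1 = 0 \<and> c2 = 0)"

text \<open>Excludes degenerate triples, which exist for resonant constants when \<open>n \<ge> 3\<close>.  If \<open>s1 = 1\<close>, the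
  solutions with \<open>\<phi>(0) = 0\<close> form a subspace of codimension 1; three of them have the common factor
  \<open>\<zeta>\<close> and their compatibility condition consists of fewer than \<open>n\<close> equations.  The same happens at
  \<open>1\<close>, at \<open>u_j\<close> and at infinity (where the last clause holds in particular if one of the
  polynomials has degree exactly \<open>n\<close> somewhere).  The predicate is void unless one of the
  equalities among the constants holds, and for independent solutions it is automatic for
  \<open>n = 2\<close>.\<close>

definition nondegenerate ::
  "complex \<Rightarrow> complex \<Rightarrow> ('n::finite \<Rightarrow> complex) \<Rightarrow> (complex ^ 'n) set \<Rightarrow>
   (complex ^ 'n \<Rightarrow> complex poly) set \<Rightarrow> bool" where
  "nondegenerate s1 s2 s U \<Phi> \<longleftrightarrow>
     (s1 = 1 \<longrightarrow> (\<exists>f\<in>\<Phi>. \<exists>u\<in>U. poly (f u) 0 \<noteq> 0)) \<and>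
     (s2 = 1 \<longrightarrow> (\<exists>f\<in>\<Phi>. \<exists>u\<in>U. poly (f u) 1 \<noteq> 0)) \<and>
     (\<forall>j. s j = 1 \<longrightarrow> (\<exists>f\<in>\<Phi>. \<exists>u\<in>U. poly (f u) (u $ j) \<noteq> 0)) \<and>
     (s1 + s2 + (\<Sum>j\<in>UNIV. s j) = of_nat (CARD('n) + 1) \<longrightarrow>
        (\<exists>f\<in>\<Phi>. \<exists>u\<in>U. coeff (f u) (CARD('n)) \<noteq> 0))"

definition potential_of ::
  "(complex \<times> (complex ^ 'n::finite)) set \<Rightarrow> (complex \<Rightarrow> complex ^ 'n \<Rightarrow> complex) \<Rightarrow>
   (complex ^ 'n \<Rightarrow> complex poly) \<Rightarrow> (complex \<Rightarrow> complex ^ 'n \<Rightarrow> complex) \<Rightarrow> bool" where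
  "potential_of \<Omega> W \<phi> F \<longleftrightarrow> holomorphic_pair F \<Omega> \<and>
     (\<forall>(\<zeta>, u)\<in>\<Omega>.
        deriv (\<lambda>z. F z u) \<zeta> = poly (\<phi> u) \<zeta> / W \<zeta> u \<and>
        (\<forall>i. partial_deriv i (F \<zeta>) u = - (poly (\<phi> u) (u $ i) / D i u) * (P i \<zeta> u / W \<zeta> u)))"

subsection \<open>Pseudopotentials\<close>

text \<open>The independent variables \<open>(x, y, t)\<close> are the components \<open>1, 2, 3\<close> of a point of
  \<open>complex ^ 3\<close>; \<open>u\<close> is a \<open>complex ^ 'n\<close>-valued function of them.\<close>

abbreviation x_deriv :: "(complex ^ 3 \<Rightarrow> complex ^ 'n) \<Rightarrow> 'n \<Rightarrow> complex ^ 3 \<Rightarrow> complex" where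
  "x_deriv u i p \<equiv> partial_deriv 1 (\<lambda>q. u q $ i) p"

abbreviation y_deriv :: "(complex ^ 3 \<Rightarrow> complex ^ 'n) \<Rightarrow> 'n \<Rightarrow> complex ^ 3 \<Rightarrow> complex" where
  "y_deriv u i p \<equiv> partial_deriv 2 (\<lambda>q. u q $ i) p"

abbreviation t_deriv :: "(complex ^ 3 \<Rightarrow> complex ^ 'n) \<Rightarrow> 'n \<Rightarrow> complex ^ 3 \<Rightarrow> complex" where
  "t_deriv u i p \<equiv> partial_deriv 3 (\<lambda>q. u q $ i) p"

definition compatible ::
  "(complex \<times> (complex ^ 'n::finite)) set \<Rightarrow> (complex \<Rightarrow> complex ^ 'n \<Rightarrow> complex) \<Rightarrow>
   (complex \<Rightarrow> complex ^ 'n \<Rightarrow> complex) \<Rightarrow> (complex \<Rightarrow> complex ^ 'n \<Rightarrow> complex) \<Rightarrow>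
   (complex ^ 3) set \<Rightarrow> (complex ^ 3 \<Rightarrow> complex ^ 'n) \<Rightarrow> bool" where
  "compatible \<Omega> F G H X u \<longleftrightarrow>
     (\<forall>p\<in>X. \<forall>\<zeta>. (\<zeta>, u p) \<in> \<Omega> \<longrightarrow>
        (let F\<zeta> = deriv (\<lambda>z. F z (u p)) \<zeta>; Fu = (\<lambda>i. partial_deriv i (F \<zeta>) (u p));
             G\<zeta> = deriv (\<lambda>z. G z (u p)) \<zeta>; Gu = (\<lambda>i. partial_deriv i (G \<zeta>) (u p));
             H\<zeta> = deriv (\<lambda>z. H z (u p)) \<zeta>; Hu = (\<lambda>i. partial_deriv i (H \<zeta>) (u p))
         in (\<Sum>i\<in>UNIV. (H\<zeta> * Gu i - G\<zeta> * Hu i) * y_deriv u i p)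
          + (\<Sum>i\<in>UNIV. (F\<zeta> * Hu i - H\<zeta> * Fu i) * t_deriv u i p)
          + (\<Sum>i\<in>UNIV. (G\<zeta> * Fu i - F\<zeta> * Gu i) * x_deriv u i p) = 0))"

text \<open>Quasilinear systems with equations indexed by \<open>'m\<close> and unknowns by \<open>'n\<close>.\<close>

definition solves_quasilinear ::
  "('m \<Rightarrow> 'n::finite \<Rightarrow> complex ^ 'n \<Rightarrow> complex) \<Rightarrow> ('m \<Rightarrow> 'n \<Rightarrow> complex ^ 'n \<Rightarrow> complex) \<Rightarrow>
   ('m \<Rightarrow> 'n \<Rightarrow> complex ^ 'n \<Rightarrow> complex) \<Rightarrow>
   (complex ^ 3) set \<Rightarrow> (complex ^ 3 \<Rightarrow> complex ^ 'n) \<Rightarrow> bool" where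
  "solves_quasilinear a b c X u \<longleftrightarrow>
     (\<forall>p\<in>X. \<forall>i. (\<Sum>j\<in>UNIV. a i j (u p) * y_deriv u j p)
              + (\<Sum>j\<in>UNIV. b i j (u p) * t_deriv u j p)
              + (\<Sum>j\<in>UNIV. c i j (u p) * x_deriv u j p) = 0)"

definition independent_equations_at ::
  "('m::finite \<Rightarrow> 'n \<Rightarrow> complex ^ 'n \<Rightarrow> complex) \<Rightarrow> ('m \<Rightarrow> 'n \<Rightarrow> complex ^ 'n \<Rightarrow> complex) \<Rightarrow>
   ('m \<Rightarrow> 'n \<Rightarrow> complex ^ 'n \<Rightarrow> complex) \<Rightarrow> complex ^ 'n \<Rightarrow> bool" where
  "independent_equations_at a b c v \<longleftrightarrow>
     (\<forall>r :: 'm \<Rightarrow> complex.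
        (\<forall>j. (\<Sum>i\<in>UNIV. r i * a i j v) = 0 \<and> (\<Sum>i\<in>UNIV. r i * b i j v) = 0 \<and>
             (\<Sum>i\<in>UNIV. r i * c i j v) = 0) \<longrightarrow> (\<forall>i. r i = 0))"

text \<open>Linear independence of the equations is meant at the generic point of \<open>U\<close>: for \<open>n \<ge> 3\<close> the
  rank of the compatibility condition can drop on a proper analytic subset.\<close>

definition independent_quasilinear_system ::
  "(complex ^ 'n::finite) set \<Rightarrow> ('m::finite \<Rightarrow> 'n \<Rightarrow> complex ^ 'n \<Rightarrow> complex) \<Rightarrow>
   ('m \<Rightarrow> 'n \<Rightarrow> complex ^ 'n \<Rightarrow> complex) \<Rightarrow> ('m \<Rightarrow> 'n \<Rightarrow> complex ^ 'n \<Rightarrow> complex) \<Rightarrow> bool" where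
  "independent_quasilinear_system U a b c \<longleftrightarrow>
     (\<forall>i j. holomorphic_vec (a i j) U \<and> holomorphic_vec (b i j) U \<and> holomorphic_vec (c i j) U) \<and>
     (\<exists>V. open V \<and> V \<subseteq> U \<and> U \<subseteq> closure V \<and> (\<forall>v\<in>V. independent_equations_at a b c v))"

definition pseudopotential ::
  "(complex \<times> (complex ^ 'n::finite)) set \<Rightarrow> (complex \<Rightarrow> complex ^ 'n \<Rightarrow> complex) \<Rightarrow>
   (complex \<Rightarrow> complex ^ 'n \<Rightarrow> complex) \<Rightarrow> (complex \<Rightarrow> complex ^ 'n \<Rightarrow> complex) \<Rightarrow>
   ('m \<Rightarrow> 'n \<Rightarrow> complex ^ 'n \<Rightarrow> complex) \<Rightarrow> ('m \<Rightarrow> 'n \<Rightarrow> complex ^ 'n \<Rightarrow> complex) \<Rightarrow>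
   ('m \<Rightarrow> 'n \<Rightarrow> complex ^ 'n \<Rightarrow> complex) \<Rightarrow> bool" where
  "pseudopotential \<Omega> F G H a b c \<longleftrightarrow>
     (\<forall>X u. open X \<and> (\<forall>i. holomorphic_vec (\<lambda>p. u p $ i) X) \<and> u ` X \<subseteq> snd ` \<Omega> \<longrightarrow>
        (compatible \<Omega> F G H X u \<longleftrightarrow> solves_quasilinear a b c X u))"

end

theory Submission
  imports Defs "HOL-Complex_Analysis.Conformal_Mappings" "HOL-Computational_Algebra.Fundamental_Theorem_Algebra"
begin

text \<open>
  Up to the factor \<open>\<zeta> (\<zeta> - 1) \<Prod>(\<zeta> - u_m) / W^2\<close>, the compatibility condition is a polynomial in \<open>\<zeta>\<close> of
  degree at most \<open>n - 1\<close>, whose coefficients are \<open>n\<close> quasilinear equations; the coefficient of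
  \<open>u_{jy} / D_j\<close> is the Bezoutian of \<open>\<phi>_1\<close> and \<open>\<phi>_2\<close> at \<open>(\<zeta>, u_j)\<close>, and cyclically.  A linear relation
  between the equations yields polynomials \<open>B\<phi>\<close> of degree less than \<open>n\<close> with
  \<open>\<phi>_b B\<phi>_a = \<phi>_a B\<phi>_b\<close>, so that it exists only where the three solutions have a common root on the
  projective line.

  Suppose that this happens on an open set.  By (L), common roots at \<open>0\<close>, \<open>1\<close>, \<open>u_j\<close> or infinity
  lead to the excluded resonances or make all \<open>\<phi>(u_i)\<close> vanish.  For any other common root \<open>c\<close>, write
  \<open>\<phi> = g \<psi>\<close> with \<open>g\<close> the greatest common divisor.  Differentiating the common root in the direction
  \<open>u_i\<close> and inserting (L) shows that the vector of the \<open>\<phi>(u_i)\<close> is a multiple of that of the \<open>\<psi>(c)\<close>,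
  for all \<open>i\<close> with at most one exception.  A combination of the solutions with \<open>\<psi>(c) = 0\<close> therefore
  vanishes doubly at \<open>c\<close> and at \<open>n - 1\<close> of the \<open>u_i\<close>, hence is zero.  So the solutions are
  proportional to each other at every point, and by (L) the factors of proportionality are constants,
  which contradicts linear independence.\<close>

subsection \<open>Analytic functions of several variables\<close>

lemma has_derivative_coordinate_line:
  fixes p :: "complex ^ 'k::finite"
  shows "((\<lambda>t. \<chi> j. if j = i then t else p $ j) has_derivative (\<lambda>h. \<chi> j. if j = i then h else 0)) (at t0)"
proof -
  have "((\<lambda>t. \<Sum>j\<in>UNIV. axis j (if j = i then t else p $ j)) has_derivative
      (\<lambda>h. \<Sum>j\<in>UNIV. axis j (if j = i then h else 0))) (at t0)"
  proof (intro has_derivative_sum)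
    fix j :: 'k
    have bl: "bounded_linear (\<lambda>t::complex. axis j t :: complex ^ 'k)"
      by (intro linear_conv_bounded_linear[THEN iffD1] linearI) (auto simp: axis_def vec_eq_iff)
    show "((\<lambda>t. axis j (if j = i then t else p $ j)) has_derivative
        (\<lambda>h. axis j (if j = i then h else 0))) (at t0)"
      using bounded_linear.has_derivative[OF bl has_derivative_ident] bounded_linear.has_derivative[OF bl has_derivative_const]
      by (cases "j = i") auto
  qed
  moreover have "(\<Sum>j\<in>UNIV. axis j (f j)) = (\<chi> j. f j)" for f :: "'k \<Rightarrow> complex"
    by (simp add: vec_eq_iff axis_def if_distrib cong: if_cong)
  ultimately show ?thesis by simp
qed

lemma has_partial_deriv_at:
  fixes f :: "complex ^ 'k::finite \<Rightarrow> complex"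
  assumes "(f has_derivative (\<lambda>h. \<Sum>j\<in>UNIV. d $ j * h $ j)) (at p)"
  shows "((\<lambda>t. f (\<chi> j. if j = i then t else p $ j)) has_field_derivative d $ i) (at (p $ i))"
proof -
  have eq: "(\<chi> j. if j = i then p $ i else p $ j) = p"
    by (simp add: vec_eq_iff)
  have "((\<lambda>t. f (\<chi> j. if j = i then t else p $ j)) has_derivative
     (\<lambda>h. \<Sum>j\<in>UNIV. d $ j * (\<chi> j. if j = i then h else 0) $ j)) (at (p $ i))"
    using has_derivative_compose[OF has_derivative_coordinate_line[of i p "p $ i"], of f "\<lambda>h. \<Sum>j\<in>UNIV. d $ j * h $ j"] assms
    by (simp add: eq)
  then show ?thesis
    by (simp add: has_field_derivative_def if_distrib cong: if_cong)
qed

lemma partial_deriv_eqI: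
  assumes "(f has_derivative (\<lambda>h. \<Sum>j\<in>UNIV. d $ j * h $ j)) (at p)"
  shows "partial_deriv i f p = d $ i"
  unfolding partial_deriv_def by (rule DERIV_imp_deriv[OF has_partial_deriv_at[OF assms]])

text \<open>\<open>holomorphic_vec\<close> only asserts that some coefficient vector exists;
  restriction to coordinate lines forces its entries to be the values of
  \<open>partial_deriv\<close>.\<close>

lemma holomorphic_vec_has_derivative:
  assumes "holomorphic_vec f X" "p \<in> X"
  shows "(f has_derivative (\<lambda>h. \<Sum>j\<in>UNIV. partial_deriv j f p * h $ j)) (at p)"
proof -
  obtain d where d: "(f has_derivative (\<lambda>h. \<Sum>j\<in>UNIV. d $ j * h $ j)) (at p)"
    using assms unfolding holomorphic_vec_def by blast
  with partial_deriv_eqI[OF d] show ?thesis by simp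
qed

lemma holomorphic_vec_partial:
  assumes "holomorphic_vec f X" "p \<in> X"
  shows "((\<lambda>t. f (\<chi> j. if j = i then t else p $ j)) has_field_derivative partial_deriv i f p) (at (p $ i))"
proof -
  obtain d where d: "(f has_derivative (\<lambda>h. \<Sum>j\<in>UNIV. d $ j * h $ j)) (at p)"
    using assms unfolding holomorphic_vec_def by blast
  show ?thesis using has_partial_deriv_at[OF d] partial_deriv_eqI[OF d] by metis
qed

lemma holomorphic_vec_subset: "holomorphic_vec f X \<Longrightarrow> Y \<subseteq> X \<Longrightarrow> holomorphic_vec f Y"
  unfolding holomorphic_vec_def by blast

lemma holomorphic_vec_continuous_on: "holomorphic_vec f X \<Longrightarrow> continuous_on X f"
  by (intro continuous_at_imp_continuous_on ballI has_derivative_continuous[OF holomorphic_vec_has_derivative])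

lemma holomorphic_vec_const [simp]: "holomorphic_vec (\<lambda>_. c) X"
  unfolding holomorphic_vec_def
  by (intro ballI exI[of _ 0]) simp

lemma holomorphic_vec_component [simp]: "holomorphic_vec (\<lambda>u. u $ i) X"
  unfolding holomorphic_vec_def
proof (intro ballI exI[of _ "axis i 1"])
  fix p :: "complex ^ 'a"
  have "(\<lambda>h::complex ^ 'a. \<Sum>j\<in>UNIV. axis i 1 $ j * h $ j) = (\<lambda>h. h $ i)"
    by (auto simp: axis_def fun_eq_iff if_distrib[of "\<lambda>a. a * _"] cong: if_cong)
  then show "((\<lambda>u. u $ i) has_derivative (\<lambda>h. \<Sum>j\<in>UNIV. axis i 1 $ j * h $ j)) (at p)"
    by (simp add: bounded_linear_vec_nth bounded_linear_imp_has_derivative)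
qed

lemma holomorphic_vec_add:
  assumes "holomorphic_vec f X" "holomorphic_vec g X"
  shows "holomorphic_vec (\<lambda>u. f u + g u) X"
  unfolding holomorphic_vec_def
proof
  fix p assume p: "p \<in> X"
  note d = holomorphic_vec_has_derivative[OF assms(1) p] holomorphic_vec_has_derivative[OF assms(2) p]
  show "\<exists>d. ((\<lambda>u. f u + g u) has_derivative (\<lambda>h. \<Sum>i\<in>UNIV. d $ i * h $ i)) (at p)"
    by (rule exI[of _ "\<chi> i. partial_deriv i f p + partial_deriv i g p"])
      (use has_derivative_add[OF d] in \<open>simp add: sum.distrib algebra_simps\<close>)
qed

lemma holomorphic_vec_mult:
  assumes "holomorphic_vec f X" "holomorphic_vec g X"
  shows "holomorphic_vec (\<lambda>u. f u * g u) X"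
  unfolding holomorphic_vec_def
proof
  fix p assume p: "p \<in> X"
  note d = holomorphic_vec_has_derivative[OF assms(1) p] holomorphic_vec_has_derivative[OF assms(2) p]
  show "\<exists>d. ((\<lambda>u. f u * g u) has_derivative (\<lambda>h. \<Sum>i\<in>UNIV. d $ i * h $ i)) (at p)"
    by (rule exI[of _ "\<chi> i. f p * partial_deriv i g p + partial_deriv i f p * g p"])
      (use has_derivative_mult[OF d] in \<open>simp add: sum.distrib sum_distrib_left algebra_simps\<close>)
qed

lemma holomorphic_vec_inverse:
  assumes "holomorphic_vec f X" "\<And>u. u \<in> X \<Longrightarrow> f u \<noteq> 0"
  shows "holomorphic_vec (\<lambda>u. inverse (f u)) X"
  unfolding holomorphic_vec_def
proof
  fix p assume p: "p \<in> X"
  note d = holomorphic_vec_has_derivative[OF assms(1) p]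
  show "\<exists>d. ((\<lambda>u. inverse (f u)) has_derivative (\<lambda>h. \<Sum>i\<in>UNIV. d $ i * h $ i)) (at p)"
    by (rule exI[of _ "\<chi> i. - (inverse (f p) * partial_deriv i f p * inverse (f p))"])
      (use Deriv.has_derivative_inverse[OF assms(2)[OF p] d] in
        \<open>simp add: sum_distrib_left sum_negf algebra_simps\<close>)
qed

lemma holomorphic_vec_diff:
  assumes "holomorphic_vec f X" "holomorphic_vec g X"
  shows "holomorphic_vec (\<lambda>u. f u - g u) X"
  using holomorphic_vec_add[OF assms(1) holomorphic_vec_mult[OF holomorphic_vec_const[of "-1"] assms(2)]]
  by simp

lemma holomorphic_vec_divide:
  assumes "holomorphic_vec f X" "holomorphic_vec g X" "\<And>u. u \<in> X \<Longrightarrow> g u \<noteq> 0"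
  shows "holomorphic_vec (\<lambda>u. f u / g u) X"
  unfolding divide_inverse by (intro holomorphic_vec_mult holomorphic_vec_inverse assms)

lemma holomorphic_vec_sum:
  "(\<And>k. k \<in> A \<Longrightarrow> holomorphic_vec (f k) X) \<Longrightarrow> holomorphic_vec (\<lambda>u. \<Sum>k\<in>A. f k u) X"
  by (induction A rule: infinite_finite_induct) (auto intro: holomorphic_vec_add)

lemma holomorphic_vec_prod:
  "(\<And>k. k \<in> A \<Longrightarrow> holomorphic_vec (f k) X) \<Longrightarrow> holomorphic_vec (\<lambda>u. \<Prod>k\<in>A. f k u) X"
  by (induction A rule: infinite_finite_induct) (auto intro: holomorphic_vec_mult)

lemma holomorphic_vec_power: "holomorphic_vec f X \<Longrightarrow> holomorphic_vec (\<lambda>u. f u ^ k) X"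
  by (induction k) (auto intro: holomorphic_vec_mult)

lemma holomorphic_vec_cong:
  assumes "holomorphic_vec f X" "open X" "\<And>u. u \<in> X \<Longrightarrow> f u = g u"
  shows "holomorphic_vec g X"
  unfolding holomorphic_vec_def
proof
  fix p assume p: "p \<in> X"
  show "\<exists>d. (g has_derivative (\<lambda>h. \<Sum>i\<in>UNIV. d $ i * h $ i)) (at p)"
    using has_derivative_transform_within_open[OF holomorphic_vec_has_derivative[OF assms(1) p] assms(2) p assms(3)]
    by (intro exI[of _ "\<chi> i. partial_deriv i f p"]) simp
qed

section \<open>The identity theorem in several variables\<close>

text \<open>Chain rule: the derivative of the line followed by a complex linear form is
  multiplication by a complex number, so the theory of one variable applies.\<close>

lemma holomorphic_vec_along_line:
  fixes f :: "complex ^ 'k::finite \<Rightarrow> complex"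
  assumes "holomorphic_vec f X"
  shows "(\<lambda>t. f (\<chi> i. p $ i + t * v $ i)) holomorphic_on {t. (\<chi> i. p $ i + t * v $ i) \<in> X}"
proof (rule holomorphic_onI)
  fix t0 assume "t0 \<in> {t. (\<chi> i. p $ i + t * v $ i) \<in> X}"
  then obtain d where d: "(f has_derivative (\<lambda>h. \<Sum>j\<in>UNIV. d $ j * h $ j)) (at (\<chi> i. p $ i + t0 * v $ i))"
    using assms unfolding holomorphic_vec_def by blast
  have l: "((\<lambda>t. \<chi> i. p $ i + t * v $ i) has_derivative (\<lambda>h. \<chi> i. h * v $ i)) (at t0)"
  proof -
    have bl: "bounded_linear (\<lambda>h. (\<chi> i. h * v $ i) :: complex ^ 'k)"
      by (intro linear_conv_bounded_linear[THEN iffD1] linearI)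
        (auto simp: vec_eq_iff algebra_simps)
    have "(\<lambda>t. \<chi> i. p $ i + t * v $ i) = (\<lambda>t. p + (\<chi> i. t * v $ i))"
      by (auto simp: fun_eq_iff vec_eq_iff)
    then show ?thesis
      by (auto intro!: derivative_eq_intros bounded_linear_imp_has_derivative bl)
  qed
  have "((\<lambda>t. f (\<chi> i. p $ i + t * v $ i)) has_derivative
     (\<lambda>h. \<Sum>j\<in>UNIV. d $ j * (\<chi> i. h * v $ i) $ j)) (at t0)"
    by (rule has_derivative_compose[OF l d])
  moreover have "(\<lambda>h. \<Sum>j\<in>UNIV. d $ j * (\<chi> i. h * v $ i) $ j) = (*) (\<Sum>j\<in>UNIV. d $ j * v $ j)"
    by (auto simp: fun_eq_iff sum_distrib_left sum_distrib_right mult_ac)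
  ultimately have "((\<lambda>t. f (\<chi> i. p $ i + t * v $ i)) has_field_derivative (\<Sum>j\<in>UNIV. d $ j * v $ j)) (at t0)"
    by (simp add: has_field_derivative_def)
  then show "(\<lambda>t. f (\<chi> i. p $ i + t * v $ i)) field_differentiable
      at t0 within {t. (\<chi> i. p $ i + t * v $ i) \<in> X}"
    using field_differentiable_def has_field_derivative_at_within by blast
qed

text \<open>The complex line through \<open>q\<close> and \<open>x\<close> meets the ball in a
  convex set of parameters containing 0 and 1. The one-variable identity theorem on this slice
  carries the zeros near \<open>q\<close> to \<open>x\<close>.\<close>

lemma holomorphic_vec_identity_ball:
  fixes f :: "complex ^ 'k::finite \<Rightarrow> complex"
  assumes f: "holomorphic_vec f (ball p r)" and q: "q \<in> ball p r"
    and near: "eventually (\<lambda>v. f v = 0) (nhds q)" and x: "x \<in> ball p r"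
  shows "f x = 0"
proof -
  define L where "L = (\<lambda>t. (\<chi> i. q $ i + t * (x - q) $ i) :: complex ^ 'k)"
  define S where "S = {t. L t \<in> ball p r}"
  have contL: "continuous_on UNIV L"
    unfolding L_def by (intro continuous_intros)
  have opS: "open S"
    using open_vimage[OF open_ball contL] by (simp add: S_def vimage_def)
  have Lconv: "L ((1 - a) *\<^sub>R s + a *\<^sub>R t) = (1 - a) *\<^sub>R L s + a *\<^sub>R L t" for a s t
    unfolding L_def by (simp add: vec_eq_iff) (simp add: scaleR_conv_of_real algebra_simps)
  have "convex S"
    unfolding convex_alt S_def using convex_ball[of p r, unfolded convex_alt] by (auto simp: Lconv simp del: mem_ball)
  then have conS: "connected S" by (rule convex_connected)
  have L0: "L 0 = q" and L1: "L 1 = x"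
    by (auto simp: L_def vec_eq_iff)
  have S0: "0 \<in> S" and S1: "1 \<in> S" using q x by (auto simp: S_def L0 L1)
  have hol: "(\<lambda>t. f (L t)) holomorphic_on S"
    using holomorphic_vec_along_line[OF f, of q "x - q"] by (simp add: L_def S_def)
  obtain A where A: "open A" "q \<in> A" "\<And>v. v \<in> A \<Longrightarrow> f v = 0"
    using near unfolding eventually_nhds by blast
  have opA: "open (L -` A \<inter> S)"
    by (intro open_Int opS open_vimage A contL)
  have "0 \<in> L -` A \<inter> S" using A S0 by (simp add: L0)
  then have "(\<lambda>t. f (L t)) 1 = 0"
    using analytic_continuation_open[OF opA opS _ conS _ hol holomorphic_on_const[of 0], of 1] A S1 by auto
  then show ?thesis by (simp add: L1)
qed

text \<open>The set of points near which \<open>f\<close> vanishes is open. It is also closed in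
  \<open>U\<close>: a small ball around a limit point meets it and then lies inside it by the
  version for balls. Connectedness leaves only \<open>U\<close>.\<close>

lemma holomorphic_vec_identity:
  fixes f :: "complex ^ 'k::finite \<Rightarrow> complex"
  assumes f: "holomorphic_vec f U" and U: "open U" "connected U"
    and O: "open O'" "O' \<noteq> {}" "O' \<subseteq> U" and zero: "\<And>u. u \<in> O' \<Longrightarrow> f u = 0" and x: "x \<in> U"
  shows "f x = 0"
proof -
  define Z where "Z = {u \<in> U. eventually (\<lambda>v. f v = 0) (nhds u)}"
  have Zsub: "O' \<subseteq> Z"
    using O zero unfolding Z_def eventually_nhds by blast
  have opZ: "open Z"
  proof (subst open_subopen, intro ballI)
    fix u assume u: "u \<in> Z"
    then obtain A where "open A" "u \<in> A" "\<And>v. v \<in> A \<Longrightarrow> f v = 0"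
      unfolding Z_def eventually_nhds by blast
    then show "\<exists>T. open T \<and> u \<in> T \<and> T \<subseteq> Z"
      using u U by (intro exI[of _ "A \<inter> U"]) (auto simp: Z_def eventually_nhds)
  qed
  have opc: "open (U - Z)"
  proof (subst open_subopen, intro ballI)
    fix u assume u: "u \<in> U - Z"
    then obtain r where r: "r > 0" "ball u r \<subseteq> U"
      using U openE by blast
    have "ball u r \<inter> Z = {}"
    proof (rule ccontr)
      assume "ball u r \<inter> Z \<noteq> {}"
      then obtain q where q: "q \<in> ball u r" "q \<in> Z" by blast
      have "f v = 0" if "v \<in> ball u r" for v
        using holomorphic_vec_identity_ball[OF holomorphic_vec_subset[OF f r(2)] q(1) _ that] q(2)
        by (simp add: Z_def)
      then have "u \<in> Z" using u r unfolding Z_def eventually_nhds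
        by (auto intro!: exI[of _ "ball u r"])
      with u show False by simp
    qed
    then show "\<exists>T. open T \<and> u \<in> T \<and> T \<subseteq> U - Z"
      using r by (intro exI[of _ "ball u r"]) auto
  qed
  have "U - Z = {}"
  proof (rule ccontr)
    assume ne: "U - Z \<noteq> {}"
    have "Z \<inter> U \<noteq> {}" using Zsub O by blast
    then show False
      using connectedD[OF U(2) opZ opc] ne by (auto simp: Z_def)
  qed
  then have "x \<in> Z" using x by blast
  then show ?thesis unfolding Z_def by (auto dest: eventually_nhds_x_imp_x)
qed

lemma holomorphic_vec_constant_ball:
  fixes f :: "complex ^ 'k::finite \<Rightarrow> complex"
  assumes f: "holomorphic_vec f (ball p r)"
    and z: "\<And>u i. u \<in> ball p r \<Longrightarrow> partial_deriv i f u = 0" and x: "x \<in> ball p r"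
  shows "f x = f p"
proof -
  have "(f has_derivative (\<lambda>h. 0)) (at u within ball p r)" if "u \<in> ball p r" for u
    using holomorphic_vec_has_derivative[OF f that] z[OF that]
    by (auto intro: has_derivative_at_withinI)
  then obtain c where "\<And>u. u \<in> ball p r \<Longrightarrow> f u = c"
    using has_derivative_zero_constant[OF convex_ball] by blast
  moreover have "p \<in> ball p r" using x by (metis centre_in_ball dist_self empty_iff ball_eq_empty not_le)
  ultimately show ?thesis using x by simp
qed

text \<open>By the identity theorem a function that is nonzero somewhere in \<open>U\<close> cannot
  vanish on all of the open set reached so far; by continuity it has no zero on a smaller
  one.\<close>

lemma finite_avoid_zeros:
  fixes S :: "(complex ^ 'k::finite \<Rightarrow> complex) set"
  assumes "finite S" and U: "open U" "connected U" and O: "open O'" "O' \<noteq> {}" "O' \<subseteq> U"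
    and S: "\<And>f. f \<in> S \<Longrightarrow> holomorphic_vec f U \<and> (\<exists>u\<in>U. f u \<noteq> 0)"
  shows "\<exists>V. open V \<and> V \<noteq> {} \<and> V \<subseteq> O' \<and> (\<forall>u\<in>V. \<forall>f\<in>S. f u \<noteq> 0)"
  using assms(1) S
proof (induction S)
  case empty
  then show ?case using O by auto
next
  case (insert f S)
  then obtain V where V: "open V" "V \<noteq> {}" "V \<subseteq> O'" "\<forall>u\<in>V. \<forall>f\<in>S. f u \<noteq> 0" by auto
  have f: "holomorphic_vec f U" "\<exists>u\<in>U. f u \<noteq> 0" using insert.prems by auto
  have "continuous_on V f"
    by (rule holomorphic_vec_continuous_on[OF holomorphic_vec_subset[OF f(1)]]) (use V O in blast)
  then have "open (V \<inter> f -` (- {0}))"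
    using V(1) by (intro continuous_open_preimage) auto
  moreover have "V \<inter> f -` (- {0}) \<noteq> {}"
    using holomorphic_vec_identity[OF f(1) U V(1,2)] f(2) V(3) O(3) by blast
  ultimately show ?case
    using V by (intro exI[of _ "V \<inter> f -` (- {0})"]) auto
qed

subsection \<open>Polynomials in one variable\<close>

lemma sum_coeff_eq_poly:
  fixes p :: "'a::comm_semiring_1 poly"
  assumes "degree p \<le> n"
  shows "(\<Sum>k\<le>n. coeff p k * x ^ k) = poly p x"
  unfolding poly_altdef
  by (rule sum.mono_neutral_right) (use assms in \<open>auto simp: coeff_eq_0\<close>)

lemma poly_eq_0_if_many_roots:
  fixes p :: "'a::idom poly"
  assumes "finite A" "degree p < card A" "\<And>x. x \<in> A \<Longrightarrow> poly p x = 0"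
  shows "p = 0"
proof (rule ccontr)
  assume "p \<noteq> 0"
  then have "card A \<le> card {x. poly p x = 0}" "card {x. poly p x = 0} \<le> degree p"
    using assms by (auto intro!: card_mono poly_roots_finite card_poly_roots_bound)
  with assms show False by simp
qed

lemma poly_cofinite_eqI:
  fixes p q :: "complex poly"
  assumes "finite A" "\<And>x. x \<notin> A \<Longrightarrow> poly p x = poly q x"
  shows "p = q"
proof (rule ccontr)
  assume "p \<noteq> q"
  then have "finite {x. poly (p - q) x = 0}" by (intro poly_roots_finite) auto
  moreover have "- A \<subseteq> {x. poly (p - q) x = 0}" using assms by auto
  ultimately have "finite (- A)" using finite_subset by blast
  then show False using assms(1) by (metis Compl_partition finite_UnI infinite_UNIV_char_0)
qed

text \<open>At \<open>c\<close> the product \<open>h * k\<close> vanishes twice and \<open>g\<close>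
  does not vanish, so \<open>c\<close> is a double root of \<open>f\<close>. Together with
  \<open>A\<close> this makes \<open>card A + 2\<close> roots, more than the degree allows.\<close>

lemma poly_double_root_eq_0:
  fixes f g h k :: "complex poly"
  assumes f: "f * g = h * k" "poly g c \<noteq> 0" "poly h c = 0" "poly k c = 0"
    and A: "finite A" "c \<notin> A" "\<And>x. x \<in> A \<Longrightarrow> poly f x = 0" "degree f \<le> card A + 1"
  shows "f = 0"
proof -
  obtain h' k' where hk: "h = [:- c, 1:] * h'" "k = [:- c, 1:] * k'"
    using f(3,4) unfolding poly_eq_0_iff_dvd by (blast elim: dvdE)
  have "poly f c = 0" using arg_cong[OF f(1), of "\<lambda>p. poly p c"] f(2,3) by simp
  then obtain f' where f': "f = [:- c, 1:] * f'" unfolding poly_eq_0_iff_dvd by (blast elim: dvdE)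
  have "[:- c, 1:] * (f' * g) = [:- c, 1:] * ([:- c, 1:] * (h' * k'))"
    using f(1) unfolding f' hk by (simp only: mult_ac)
  then have "f' * g = [:- c, 1:] * (h' * k')"
    by (subst (asm) mult_left_cancel) auto
  from arg_cong[OF this, of "\<lambda>p. poly p c"] have c: "poly f' c = 0" using f(2) by simp
  have "f' = 0"
  proof (cases "f' = 0")
    case False
    then have "degree f = Suc (degree f')" unfolding f' by (subst degree_mult_eq) auto
    then show ?thesis
      using A c by (intro poly_eq_0_if_many_roots[of "insert c A"]) (auto simp: f')
  qed simp
  then show ?thesis by (simp add: f')
qed

lemma coeff_prod_linear_card:
  fixes x :: "'b \<Rightarrow> 'a::idom"
  shows "coeff (\<Prod>i\<in>A. [:- x i, 1:]) (card A) = 1" "degree (\<Prod>i\<in>A. [:- x i, 1:]) = card A"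
proof -
  show d: "degree (\<Prod>i\<in>A. [:- x i, 1:]) = card A"
    by (subst degree_prod_eq_sum_degree) auto
  have "lead_coeff (\<Prod>i\<in>A. [:- x i, 1:]) = 1"
    by (simp add: lead_coeff_prod)
  then show "coeff (\<Prod>i\<in>A. [:- x i, 1:]) (card A) = 1" by (simp add: d)
qed

lemma degree_eq_sum_order:
  fixes p :: "complex poly"
  assumes "p \<noteq> 0"
  shows "degree p = (\<Sum>z | poly p z = 0. order z p)"
proof -
  have "degree p = degree (smult (lead_coeff p) (\<Prod>z | poly p z = 0. [:- z, 1:] ^ order z p))"
    by (simp only: complex_poly_decompose)
  also have "\<dots> = (\<Sum>z | poly p z = 0. degree ([:- z, 1:] ^ order z p))"
    using assms by (simp add: degree_prod_eq_sum_degree)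
  finally show ?thesis by (simp add: degree_linear_power)
qed

text \<open>If no point had larger order in \<open>p\<close> than in \<open>q\<close>, summing the
  orders over all roots would give \<open>degree p \<le> degree q\<close>.\<close>

lemma exists_order_less:
  fixes p q :: "complex poly"
  assumes "q \<noteq> 0" "degree q < degree p"
  obtains c where "order c q < order c p"
proof -
  have p: "p \<noteq> 0" using assms by auto
  have "\<exists>c. order c q < order c p"
  proof (rule ccontr)
    assume "\<nexists>c. order c q < order c p"
    then have le: "order c p \<le> order c q" for c by (meson not_le)
    have "degree p \<le> (\<Sum>z | poly p z = 0. order z q)"
      unfolding degree_eq_sum_order[OF p] by (intro sum_mono le)
    also have "\<dots> \<le> (\<Sum>z | poly q z = 0. order z q)"
    proof (rule sum_mono2)
      show "{z. poly p z = 0} \<subseteq> {z. poly q z = 0}"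
        using le p assms(1) by (metis (mono_tags, lifting) Collect_mono le_zero_eq order_root)
    qed (use assms(1) poly_roots_finite in auto)
    also have "\<dots> = degree q" using degree_eq_sum_order[OF assms(1)] by simp
    finally show False using assms(2) by simp
  qed
  then show ?thesis using that by blast
qed

text \<open>The polynomials in \<open>z\<close> which are the coefficients of \<open>x ^ k\<close> in the Bezoutian
  \<open>(p(x) q(z) - q(x) p(z)) / (x - z)\<close>.\<close>

definition bez :: "'a::comm_ring_1 poly \<Rightarrow> 'a poly \<Rightarrow> nat \<Rightarrow> 'a poly" where
  "bez p q k = q * poly_shift (Suc k) p - p * poly_shift (Suc k) q"

lemma degree_poly_shift_le: "degree (poly_shift k p) \<le> degree p - k"
  by (rule degree_le) (auto simp: coeff_poly_shift intro!: coeff_eq_0)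

lemma poly_shift_Suc: "poly_shift k p = pCons (coeff p k) (poly_shift (Suc k) p)"
  by (auto simp: poly_eq_iff coeff_poly_shift coeff_pCons split: nat.splits)

text \<open>Horner's scheme: the values of the shifts at \<open>z\<close> satisfy
  \<open>?s k = coeff p k + z * ?s (Suc k)\<close>, so the product with \<open>x - z\<close>
  telescopes.\<close>

lemma poly_diff_factor:
  fixes p :: "'a::comm_ring_1 poly"
  assumes "degree p \<le> n"
  shows "poly p x - poly p z = (x - z) * (\<Sum>k<n. poly (poly_shift (Suc k) p) z * x ^ k)"
proof -
  let ?s = "\<lambda>k. poly (poly_shift k p) z"
  have s: "?s k = coeff p k + z * ?s (Suc k)" for k
    by (subst poly_shift_Suc) simp
  have "(x - z) * (\<Sum>k<n. ?s (Suc k) * x ^ k) = (\<Sum>k<n. ?s (Suc k) * x ^ Suc k - ?s k * x ^ k + coeff p k * x ^ k)"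
    unfolding sum_distrib_left
  proof (rule sum.cong)
    fix k
    show "(x - z) * (?s (Suc k) * x ^ k) = ?s (Suc k) * x ^ Suc k - ?s k * x ^ k + coeff p k * x ^ k"
      unfolding s[of k] by (simp add: algebra_simps)
  qed simp
  also have "\<dots> = ?s n * x ^ n - ?s 0 + (\<Sum>k<n. coeff p k * x ^ k)"
    by (simp add: sum.distrib sum_lessThan_telescope[of "\<lambda>k. ?s k * x ^ k"] del: power_Suc)
  also have "?s n = coeff p n"
  proof -
    have "poly_shift n p = [:coeff p n:]"
      using assms by (auto simp: poly_eq_iff coeff_poly_shift coeff_pCons coeff_eq_0 split: nat.splits)
    then show ?thesis by simp
  qed
  also have "coeff p n * x ^ n - ?s 0 + (\<Sum>k<n. coeff p k * x ^ k) = (\<Sum>k\<le>n. coeff p k * x ^ k) - poly p z"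
    by (simp add: lessThan_Suc_atMost[symmetric])
  also have "\<dots> = poly p x - poly p z" using sum_coeff_eq_poly[OF assms] by simp
  finally show ?thesis by simp
qed

lemma bez_expansion:
  fixes p q :: "'a::comm_ring_1 poly"
  assumes "degree p \<le> n" "degree q \<le> n"
  shows "poly p x * poly q z - poly q x * poly p z = (x - z) * (\<Sum>k<n. poly (bez p q k) z * x ^ k)"
proof -
  have "poly p x * poly q z - poly q x * poly p z =
      poly q z * (poly p x - poly p z) - poly p z * (poly q x - poly q z)"
    by (simp add: algebra_simps)
  also have "\<dots> = (x - z) * (poly q z * (\<Sum>k<n. poly (poly_shift (Suc k) p) z * x ^ k)
      - poly p z * (\<Sum>k<n. poly (poly_shift (Suc k) q) z * x ^ k))"
    unfolding poly_diff_factor[OF assms(1)] poly_diff_factor[OF assms(2)] by (simp add: algebra_simps)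
  also have "\<dots> = (x - z) * (\<Sum>k<n. poly (bez p q k) z * x ^ k)"
    by (simp add: bez_def sum_distrib_left sum_subtractf algebra_simps)
  finally show ?thesis .
qed

lemma poly_shift_cutoff: "monom 1 k * poly_shift k p + poly_cutoff k p = (p :: 'a::comm_semiring_1 poly)"
  by (auto simp: poly_eq_iff coeff_monom_mult coeff_poly_shift coeff_poly_cutoff)

text \<open>Taken separately, the two products may have degree \<open>2 * n - k - 1\<close>. After
  multiplication by \<open>monom 1 (Suc k)\<close> the terms \<open>p * q\<close> cancel, and the
  shifts are replaced by cutoffs of degree at most \<open>k\<close>.\<close>

lemma degree_bez_le:
  fixes p q :: "'a::idom poly"
  assumes "degree p \<le> n" "degree q \<le> n"
  shows "degree (bez p q k) \<le> n - 1"
proof (cases "bez p q k = 0")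
  case False
  let ?m = "monom 1 (Suc k) :: 'a poly"
  have cut: "degree (poly_cutoff (Suc k) r) \<le> k" for r :: "'a poly"
    by (rule degree_le) (auto simp: coeff_poly_cutoff)
  have sh: "?m * poly_shift (Suc k) r = r - poly_cutoff (Suc k) r" for r :: "'a poly"
    using poly_shift_cutoff[of "Suc k" r] by (simp add: algebra_simps)
  have "?m * bez p q k = q * (?m * poly_shift (Suc k) p) - p * (?m * poly_shift (Suc k) q)"
    by (simp add: bez_def algebra_simps)
  also have "\<dots> = p * poly_cutoff (Suc k) q - q * poly_cutoff (Suc k) p"
    by (simp add: sh algebra_simps)
  finally have "degree (?m * bez p q k) \<le> n + k"
    using assms cut[of p] cut[of q]
    by (auto intro!: degree_diff_le order_trans[OF degree_mult_le] add_mono)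
  moreover have "degree (?m * bez p q k) = Suc k + degree (bez p q k)"
    using False by (subst degree_mult_eq) (auto simp: degree_monom_eq)
  ultimately show ?thesis by simp
qed simp

text \<open>Triangularity: in the coefficient of index \<open>n - 1 - k\<close> the terms with
  \<open>j > k\<close> vanish for degree reasons and those with \<open>j < k\<close> by induction,
  which isolates \<open>\<rho> k * coeff p n\<close>.\<close>

lemma poly_shift_combination_eq_0:
  fixes p :: "'a::idom poly"
  assumes zero: "(\<Sum>k<n. smult (\<rho> k) (poly_shift (Suc k) p)) = 0"
    and p: "degree p \<le> n" "coeff p n \<noteq> 0" and k: "k < n"
  shows "\<rho> k = 0"
  using k
proof (induction k rule: less_induct)
  case (less k)
  have "0 = coeff (\<Sum>j<n. smult (\<rho> j) (poly_shift (Suc j) p)) (n - 1 - k)"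
    by (simp add: zero)
  also have "\<dots> = (\<Sum>j<n. \<rho> j * coeff p (n - 1 - k + Suc j))"
    by (simp add: coeff_sum coeff_poly_shift)
  also have "\<dots> = (\<Sum>j<n. if j = k then \<rho> k * coeff p n else 0)"
  proof (rule sum.cong)
    fix j assume "j \<in> {..<n}"
    show "\<rho> j * coeff p (n - 1 - k + Suc j) = (if j = k then \<rho> k * coeff p n else 0)"
    proof (cases j k rule: linorder_cases)
      case greater
      then have "coeff p (n - 1 - k + Suc j) = 0" using p less.prems by (intro coeff_eq_0) auto
      then show ?thesis using greater by simp
    qed (use less in auto)
  qed simp
  also have "\<dots> = \<rho> k * coeff p n" using less.prems by simp
  finally show ?case using p by simp
qed

subsection \<open>Tuples of polynomials with a common factor\<close>

text \<open>For polynomials of degree at most \<open>n\<close>, not all of them zero, this says that their common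
  zeros on the projective line, counted with multiplicity, number at least \<open>n - m\<close>.\<close>

definition reduces_to :: "nat \<Rightarrow> ('a \<Rightarrow> complex poly) \<Rightarrow> bool" where
  "reduces_to m \<Phi> \<longleftrightarrow> (\<exists>\<psi>. (\<forall>a. degree (\<psi> a) \<le> m) \<and> (\<exists>a. \<psi> a \<noteq> 0) \<and> (\<forall>a b. \<Phi> a * \<psi> b = \<Phi> b * \<psi> a))"

text \<open>The members are scalar multiples of a single polynomial. Vanishing minors of values
  express this also when some members are zero.\<close>

definition proportional :: "('a \<Rightarrow> complex poly) \<Rightarrow> bool" where
  "proportional \<Phi> \<longleftrightarrow> (\<forall>a b x y. poly (\<Phi> a) x * poly (\<Phi> b) y = poly (\<Phi> a) y * poly (\<Phi> b) x)"

lemma reduces_to_mono: "reduces_to m \<Phi> \<Longrightarrow> m \<le> m' \<Longrightarrow> reduces_to m' \<Phi>"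
  unfolding reduces_to_def by (meson order_trans)

text \<open>A reduction of degree 0 consists of constants \<open>k a\<close>, and every
  \<open>\<Phi> a\<close> is \<open>k a / k c\<close> times \<open>\<Phi> c\<close>.\<close>

lemma reduces_to_0_imp_proportional:
  assumes "reduces_to 0 \<Phi>"
  shows "proportional \<Phi>"
  unfolding proportional_def
proof (intro allI)
  fix a b x y
  obtain \<psi> c where \<psi>: "\<And>a. degree (\<psi> a) \<le> 0" "\<psi> c \<noteq> 0" "\<And>a b. \<Phi> a * \<psi> b = \<Phi> b * \<psi> a"
    using assms unfolding reduces_to_def by blast
  define k where "k a = coeff (\<psi> a) 0" for a
  have k: "\<psi> a = [:k a:]" for a
    using \<psi>(1) by (metis degree_eq_zeroE coeff_pCons_0 k_def le_zero_eq)
  have kc: "k c \<noteq> 0" using \<psi>(2) k by auto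
  have e: "poly (\<Phi> a) x * k c = poly (\<Phi> c) x * k a" for a x
    using arg_cong[OF \<psi>(3)[of a c], of "\<lambda>p. poly p x"] by (simp add: k mult.commute)
  have "(poly (\<Phi> a) x * k c) * (poly (\<Phi> b) y * k c) = (poly (\<Phi> a) y * k c) * (poly (\<Phi> b) x * k c)"
    unfolding e by simp
  then show "poly (\<Phi> a) x * poly (\<Phi> b) y = poly (\<Phi> a) y * poly (\<Phi> b) x"
    using kc by simp
qed

lemma proportional_smult:
  assumes "proportional \<psi>"
  shows "smult (coeff (\<psi> b) k) (\<psi> a) = smult (coeff (\<psi> a) k) (\<psi> b)"
proof -
  have 1: "smult (poly (\<psi> b) y) (\<psi> a) = smult (poly (\<psi> a) y) (\<psi> b)" for y
    using assms unfolding proportional_def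
    by (intro poly_cofinite_eqI[of "{}"]) (auto simp: mult.commute)
  have "poly (\<psi> b) y * coeff (\<psi> a) k = poly (\<psi> a) y * coeff (\<psi> b) k" for y
    using arg_cong[OF 1[of y], of "\<lambda>p. coeff p k"] by simp
  then show ?thesis by (intro poly_cofinite_eqI[of "{}"]) (auto simp: mult.commute)
qed

section \<open>Limits of reductions\<close>

lemma subsequence_converges_finite:
  fixes f :: "nat \<Rightarrow> 'b \<Rightarrow> complex"
  assumes "finite A" "\<And>x. x \<in> A \<Longrightarrow> bounded (range (\<lambda>k. f k x))"
  shows "\<exists>r. strict_mono (r :: nat \<Rightarrow> nat) \<and> (\<forall>x\<in>A. convergent (\<lambda>k. f (r k) x))"
  using assms
proof (induction A)
  case empty
  show ?case by (rule exI[of _ id]) (simp add: strict_mono_def)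
next
  case (insert y A)
  then obtain r where r: "strict_mono (r :: nat \<Rightarrow> nat)" "\<And>x. x \<in> A \<Longrightarrow> convergent (\<lambda>k. f (r k) x)"
    by auto
  have "bounded (range (\<lambda>k. f (r k) y))"
    by (rule bounded_subset[of "range (\<lambda>k. f k y)"]) (use insert.prems in auto)
  then obtain l r' where r': "strict_mono (r' :: nat \<Rightarrow> nat)" "((\<lambda>k. f (r k) y) \<circ> r') \<longlonglongrightarrow> l"
    using bounded_imp_convergent_subsequence by blast
  show ?case
  proof (intro exI[of _ "r \<circ> r'"] conjI ballI)
    show "strict_mono (r \<circ> r')" by (rule strict_mono_o[OF r(1) r'(1)])
    fix x assume "x \<in> insert y A"
    then show "convergent (\<lambda>k. f ((r \<circ> r') k) x)"
    proof
      assume "x = y" then show ?thesis using r'(2) by (auto simp: convergent_def o_def)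
    next
      assume "x \<in> A"
      then show ?thesis using convergent_subseq_convergent[OF r(2) r'(1)] by (simp add: o_def)
    qed
  qed
qed

lemma tendsto_coeff_mult:
  fixes p q :: "'b \<Rightarrow> complex poly"
  assumes "\<And>l. ((\<lambda>k. coeff (p k) l) \<longlongrightarrow> coeff p' l) F" "\<And>l. ((\<lambda>k. coeff (q k) l) \<longlongrightarrow> coeff q' l) F"
  shows "((\<lambda>k. coeff (p k * q k) l) \<longlongrightarrow> coeff (p' * q') l) F"
  unfolding coeff_mult by (intro tendsto_intros assms)

lemma tendsto_poly_coeff:
  fixes p :: "'b \<Rightarrow> complex poly"
  assumes "\<And>l. ((\<lambda>k. coeff (p k) l) \<longlongrightarrow> coeff p' l) F" "\<And>k. degree (p k) \<le> m" "degree p' \<le> m"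
  shows "((\<lambda>k. poly (p k) x) \<longlongrightarrow> poly p' x) F"
  unfolding sum_coeff_eq_poly[OF assms(2), symmetric] sum_coeff_eq_poly[OF assms(3), symmetric]
  by (intro tendsto_intros assms)

text \<open>Scaled so that the norms of all coefficients sum to 1, the witnesses range over a
  compact set. A subsequential limit keeps this sum, hence is not zero, and inherits the degree
  bound and the relations. The converging witnesses are returned too, since derivatives are later
  taken along them.\<close>

lemma reduces_to_limit:
  fixes \<Phi> :: "nat \<Rightarrow> 'a::finite \<Rightarrow> complex poly"
  assumes red: "\<And>k. reduces_to m (\<Phi> k)"
    and lim: "\<And>a l. (\<lambda>k. coeff (\<Phi> k a) l) \<longlonglongrightarrow> coeff (\<Phi>' a) l"
  obtains r \<psi> \<psi>' where "strict_mono (r :: nat \<Rightarrow> nat)"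
    "\<And>k a b. \<Phi> (r k) a * \<psi> k b = \<Phi> (r k) b * \<psi> k a" "\<And>k a. degree (\<psi> k a) \<le> m"
    "\<And>a. degree (\<psi>' a) \<le> m" "\<exists>a. \<psi>' a \<noteq> 0" "\<And>a b. \<Phi>' a * \<psi>' b = \<Phi>' b * \<psi>' a"
    "\<And>a l. (\<lambda>k. coeff (\<psi> k a) l) \<longlonglongrightarrow> coeff (\<psi>' a) l"
proof -
  have "\<forall>k. \<exists>\<psi>. (\<forall>a. degree (\<psi> a) \<le> m) \<and> (\<exists>a. \<psi> a \<noteq> 0) \<and> (\<forall>a b. \<Phi> k a * \<psi> b = \<Phi> k b * \<psi> a)"
    using red unfolding reduces_to_def by blast
  then obtain \<xi> where \<xi>: "\<And>k a. degree (\<xi> k a) \<le> m" "\<And>k. \<exists>a. \<xi> k a \<noteq> 0"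
    "\<And>k a b. \<Phi> k a * \<xi> k b = \<Phi> k b * \<xi> k a"
    by metis
  define I where "I = (UNIV :: 'a set) \<times> {..m}"
  have finI: "finite I" by (simp add: I_def)
  define N where "N k = (\<Sum>(a, l)\<in>I. norm (coeff (\<xi> k a) l))" for k
  have Npos: "N k > 0" for k
  proof -
    obtain a where "\<xi> k a \<noteq> 0" using \<xi>(2) by blast
    then have "norm (coeff (\<xi> k a) (degree (\<xi> k a))) > 0" by simp
    moreover have "norm (coeff (\<xi> k a) (degree (\<xi> k a))) \<le> N k"
      unfolding N_def using \<xi>(1)[of k a] finI
      by (intro member_le_sum[of "(a, degree (\<xi> k a))" I "\<lambda>(a, l). norm (coeff (\<xi> k a) l)", simplified])
        (auto simp: I_def)
    ultimately show ?thesis by linarith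
  qed
  define \<psi> where "\<psi> k a = smult (complex_of_real (1 / N k)) (\<xi> k a)" for k a
  define f where "f k = (\<lambda>(a, l). coeff (\<psi> k a) l)" for k
  have sum1: "(\<Sum>x\<in>I. norm (f k x)) = 1" for k
  proof -
    have "(\<Sum>x\<in>I. norm (f k x)) = (1 / N k) * N k"
      unfolding N_def sum_distrib_left
      by (rule sum.cong) (use Npos[of k] in \<open>auto simp: f_def \<psi>_def norm_mult norm_divide N_def[symmetric]\<close>)
    then show ?thesis using Npos[of k] by simp
  qed
  have "norm (f k x) \<le> 1" if "x \<in> I" for k x
    using member_le_sum[of x I "\<lambda>x. norm (f k x)"] sum1[of k] finI that by simp
  then have "bounded (range (\<lambda>k. f k x))" if "x \<in> I" for x
    using that unfolding bounded_iff by blast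
  then obtain r where r: "strict_mono (r :: nat \<Rightarrow> nat)" "\<And>x. x \<in> I \<Longrightarrow> convergent (\<lambda>k. f (r k) x)"
    using subsequence_converges_finite[OF finI, of f] by blast
  define g where "g x = lim (\<lambda>k. f (r k) x)" for x
  have g: "(\<lambda>k. f (r k) x) \<longlonglongrightarrow> g x" if "x \<in> I" for x
    using r(2)[OF that] by (simp add: g_def convergent_LIMSEQ_iff)
  define \<psi>' where "\<psi>' a = (\<Sum>l\<le>m. monom (g (a, l)) l)" for a
  have c': "coeff (\<psi>' a) l = (if l \<le> m then g (a, l) else 0)" for a l
    by (simp add: \<psi>'_def coeff_sum)
  have d': "degree (\<psi>' a) \<le> m" for a by (rule degree_le) (simp add: c')
  have d: "degree (\<psi> k a) \<le> m" for k a
    using \<xi>(1)[of k a] by (simp add: \<psi>_def)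
  have lim\<psi>: "(\<lambda>k. coeff (\<psi> (r k) a) l) \<longlonglongrightarrow> coeff (\<psi>' a) l" for a l
  proof (cases "l \<le> m")
    case True
    then show ?thesis using g[of "(a, l)"] by (simp add: f_def c' I_def)
  next
    case False
    then have "coeff (\<psi> (r k) a) l = 0" for k using d[of "r k" a] by (intro coeff_eq_0) simp
    then show ?thesis using False by (simp add: c')
  qed
  have rel: "\<Phi> k a * \<psi> k b = \<Phi> k b * \<psi> k a" for k a b
    using \<xi>(3)[of k a b] by (simp add: \<psi>_def)
  have "(\<lambda>k. \<Sum>x\<in>I. norm (f (r k) x)) \<longlonglongrightarrow> (\<Sum>x\<in>I. norm (g x))"
    by (intro tendsto_intros g)
  then have "(\<Sum>x\<in>I. norm (g x)) = 1"
    by (simp add: sum1 LIMSEQ_const_iff)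
  then obtain x where "x \<in> I" "g x \<noteq> 0"
    by (metis (no_types, lifting) norm_zero sum.neutral zero_neq_one)
  then have ne: "\<exists>a. \<psi>' a \<noteq> 0"
    by (metis I_def SigmaE atMost_iff c' coeff_0)
  have "\<Phi>' a * \<psi>' b = \<Phi>' b * \<psi>' a" for a b
  proof (rule poly_eqI)
    fix l
    have lim': "(\<lambda>k. coeff (\<Phi> (r k) a) l) \<longlonglongrightarrow> coeff (\<Phi>' a) l" for a l
      using LIMSEQ_subseq_LIMSEQ[OF lim r(1)] by (simp add: o_def)
    have "(\<lambda>k. coeff (\<Phi> (r k) a * \<psi> (r k) b) l) \<longlonglongrightarrow> coeff (\<Phi>' a * \<psi>' b) l"
      "(\<lambda>k. coeff (\<Phi> (r k) b * \<psi> (r k) a) l) \<longlonglongrightarrow> coeff (\<Phi>' b * \<psi>' a) l"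
      by (intro tendsto_coeff_mult lim' lim\<psi>)+
    then show "coeff (\<Phi>' a * \<psi>' b) l = coeff (\<Phi>' b * \<psi>' a) l"
      unfolding rel[of _ a b] by (rule LIMSEQ_unique)
  qed
  with r(1) rel d d' ne lim\<psi> show ?thesis
    by (intro that[of r "\<lambda>k. \<psi> (r k)" \<psi>']) auto
qed

text \<open>A root shared by all \<open>\<psi> a\<close> could be divided out of the relations,
  leaving a reduction of degree \<open>m - 1\<close>.\<close>

lemma minimal_reduction_no_common_root:
  fixes \<Phi> :: "'a \<Rightarrow> complex poly"
  assumes min: "\<And>m'. m' < m \<Longrightarrow> \<not> reduces_to m' \<Phi>"
    and \<psi>: "\<And>a. degree (\<psi> a) \<le> m" "\<exists>a. \<psi> a \<noteq> 0" "\<And>a b. \<Phi> a * \<psi> b = \<Phi> b * \<psi> a"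
  shows "\<exists>a. poly (\<psi> a) c \<noteq> 0"
proof (rule ccontr)
  assume "\<not> ?thesis"
  then have "\<forall>a. \<exists>p. \<psi> a = [:- c, 1:] * p" unfolding poly_eq_0_iff_dvd by (blast elim: dvdE)
  then obtain \<xi> where \<xi>: "\<And>a. \<psi> a = [:- c, 1:] * \<xi> a" by metis
  have deg: "\<xi> a = 0 \<or> Suc (degree (\<xi> a)) \<le> m" for a
    using \<psi>(1)[of a] unfolding \<xi> by (cases "\<xi> a = 0") (auto simp: degree_mult_eq simp del: mult_pCons_left)
  obtain a where "\<psi> a \<noteq> 0" using \<psi>(2) by blast
  then have "\<xi> a \<noteq> 0" unfolding \<xi>[of a] by auto
  \<comment> \<open>The nonzero \<open>\<xi> a\<close> forces \<open>m > 0\<close>; at 0 the natural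
    subtraction would not decrease.\<close>
  then have "m - 1 < m" using deg[of a] by auto
  moreover have "reduces_to (m - 1) \<Phi>"
    unfolding reduces_to_def
  proof (intro exI[of _ \<xi>] conjI allI exI[of _ a])
    show "degree (\<xi> b) \<le> m - 1" for b using deg[of b] by auto
    show "\<xi> a \<noteq> 0" by (rule \<open>\<xi> a \<noteq> 0\<close>)
    show "\<Phi> a * \<xi> b = \<Phi> b * \<xi> a" for a b
    proof -
      have "[:- c, 1:] * (\<Phi> a * \<xi> b) = [:- c, 1:] * (\<Phi> b * \<xi> a)"
        using \<psi>(3)[of a b] unfolding \<xi> by (simp only: mult_ac)
      then show ?thesis by (subst (asm) mult_left_cancel) auto
    qed
  qed
  ultimately show False using min by blast
qed

text \<open>Some \<open>c\<close> has higher order in \<open>\<Phi> a\<close> than in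
  \<open>\<psi> a\<close>. If \<open>\<psi> d\<close> is nonzero at \<open>c\<close>, comparing
  orders in \<open>\<Phi> a * \<psi> d = \<Phi> d * \<psi> a\<close> makes \<open>c\<close> a root
  of \<open>\<Phi> d\<close>, and the relations between \<open>d\<close> and \<open>b\<close> pass
  it on to every \<open>\<Phi> b\<close>.\<close>

lemma common_root_of_reduction:
  fixes \<Phi> :: "'a \<Rightarrow> complex poly"
  assumes \<psi>: "\<And>a b. \<Phi> a * \<psi> b = \<Phi> b * \<psi> a" "\<And>c. \<exists>a. poly (\<psi> a) c \<noteq> 0"
    and lt: "degree (\<psi> a) < degree (\<Phi> a)"
  obtains c where "\<And>b. poly (\<Phi> b) c = 0"
proof -
  have a0: "\<Phi> a \<noteq> 0" using lt by auto
  have "\<psi> a \<noteq> 0"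
  proof
    assume "\<psi> a = 0"
    then have "\<psi> b = 0" for b using \<psi>(1)[of a b] a0 by simp
    then show False using \<psi>(2) by simp
  qed
  then obtain c where c: "order c (\<psi> a) < order c (\<Phi> a)" using exists_order_less lt by blast
  obtain d where d: "poly (\<psi> d) c \<noteq> 0" using \<psi>(2) by blast
  have d0: "\<psi> d \<noteq> 0" using d by auto
  have e: "\<Phi> a * \<psi> d = \<Phi> d * \<psi> a" by (rule \<psi>)
  have nz: "\<Phi> a * \<psi> d \<noteq> 0" using a0 d0 by simp
  then have "order c (\<Phi> a) + order c (\<psi> d) = order c (\<Phi> d) + order c (\<psi> a)"
    using e by (metis order_mult)
  then have "order c (\<Phi> d) > 0" using c by simp
  then have "poly (\<Phi> d) c = 0" by (metis order_0I less_irrefl)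
  then have "poly (\<Phi> b) c = 0" for b
    using arg_cong[OF \<psi>(1)[of b d], of "\<lambda>p. poly p c"] d by simp
  then show ?thesis by (rule that)
qed

subsection \<open>The linear system\<close>

definition coordinate_line :: "'k::finite \<Rightarrow> complex ^ 'k \<Rightarrow> complex \<Rightarrow> complex ^ 'k" where
  "coordinate_line i u t = (\<chi> j. if j = i then t else u $ j)"

lemma coordinate_line_self [simp]: "coordinate_line i u (u $ i) = u"
  by (simp add: coordinate_line_def vec_eq_iff)

lemma coordinate_line_nth [simp]: "j \<noteq> i \<Longrightarrow> coordinate_line i u t $ j = u $ j"
  by (simp add: coordinate_line_def)

lemma continuous_on_coordinate_line: "continuous_on UNIV (coordinate_line i u)"
  unfolding coordinate_line_def
  using has_derivative_continuous[OF has_derivative_coordinate_line]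
  by (blast intro: continuous_at_imp_continuous_on)

lemma open_coordinate_line: "open X \<Longrightarrow> open {t. coordinate_line i u t \<in> X}"
  using open_vimage[OF _ continuous_on_coordinate_line] by (simp add: vimage_def)

definition nodal_poly :: "complex ^ 'n::finite \<Rightarrow> complex poly" where
  "nodal_poly u = (\<Prod>m\<in>UNIV. [:- u $ m, 1:])"

definition P_poly :: "'n::finite \<Rightarrow> complex ^ 'n \<Rightarrow> complex poly" where
  "P_poly i u = [:0, 1:] * [:-1, 1:] * (\<Prod>m\<in>UNIV - {i}. [:- u $ m, 1:])"

text \<open>The sum \<open>(s1 - 1)/\<zeta> + (s2 - 1)/(\<zeta> - 1) + \<dots>\<close> over all the poles, with the denominators
  cleared.\<close>

definition residue_poly ::
  "complex \<Rightarrow> complex \<Rightarrow> ('n::finite \<Rightarrow> complex) \<Rightarrow> complex ^ 'n \<Rightarrow> complex poly" where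
  "residue_poly s1 s2 s u =
     smult (s1 - 1) ([:-1, 1:] * nodal_poly u) + smult (s2 - 1) ([:0, 1:] * nodal_poly u) +
     (\<Sum>m\<in>UNIV. smult (s m - 1) (P_poly m u))"

text \<open>The left-hand side of (L) as a polynomial in the spectral variable. The sum stops at
  \<open>CARD('n)\<close>, the bound on the degree of a solution.\<close>

definition poly_partial :: "'n::finite \<Rightarrow> (complex ^ 'n \<Rightarrow> complex poly) \<Rightarrow> complex ^ 'n \<Rightarrow> complex poly" where
  "poly_partial i \<phi> u = (\<Sum>k\<le>CARD('n). monom (partial_deriv i (\<lambda>v. coeff (\<phi> v) k) u) k)"

lemma poly_nodal_poly: "poly (nodal_poly u) x = (\<Prod>m\<in>UNIV. (x - u $ m))"
  by (simp add: nodal_poly_def poly_prod)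

lemma poly_P_poly: "poly (P_poly i u) x = P i x u"
  by (simp add: P_poly_def P_def poly_prod algebra_simps)

lemma poly_residue_poly:
  "poly (residue_poly s1 s2 s u) x =
     (s1 - 1) * ((x - 1) * poly (nodal_poly u) x) + (s2 - 1) * (x * poly (nodal_poly u) x) +
     (\<Sum>m\<in>UNIV. (s m - 1) * P m x u)"
  by (simp add: residue_poly_def poly_sum poly_P_poly algebra_simps)

lemma coeff_P_poly: "coeff (P_poly i (u :: complex ^ 'n::finite)) (CARD('n) + 1) = 1"
proof -
  let ?q = "\<Prod>m\<in>UNIV - {i}. [:- u $ m, 1:]"
  have c: "card (UNIV - {i} :: 'n set) = CARD('n) - 1" by simp
  have q: "lead_coeff ?q = 1" "degree ?q = CARD('n) - 1"
    using coeff_prod_linear_card[of "\<lambda>m. u $ m" "UNIV - {i}"] by (simp_all add: c)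
  then have "?q \<noteq> 0" by auto
  then have "degree (P_poly i u) = 1 + 1 + (CARD('n) - 1)"
    unfolding P_poly_def by (subst degree_mult_eq; simp add: q(2) degree_mult_eq)
  moreover have "lead_coeff (P_poly i u) = 1"
    unfolding P_poly_def lead_coeff_mult q(1) by simp
  moreover have "CARD('n) > 0" by simp
  ultimately show ?thesis by simp
qed

text \<open>Each of the \<open>CARD('n) + 2\<close> summands is a multiple of a monic polynomial of
  degree \<open>CARD('n) + 1\<close>, so the residues add up. Their sum decides about common zeros
  at infinity.\<close>

lemma coeff_residue_poly:
  fixes u :: "complex ^ 'n::finite"
  shows "coeff (residue_poly s1 s2 s u) (CARD('n) + 1) = s1 + s2 + (\<Sum>m\<in>UNIV. s m) - (CARD('n) + 2)"
proof -
  have "coeff (nodal_poly u) CARD('n) = 1" "degree (nodal_poly u) = CARD('n)"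
    using coeff_prod_linear_card[of "\<lambda>m. u $ m" UNIV] by (simp_all add: nodal_poly_def)
  then have "coeff ([:-1, 1:] * nodal_poly u) (CARD('n) + 1) = 1"
    "coeff ([:0, 1:] * nodal_poly u) (CARD('n) + 1) = 1"
    by (simp_all add: coeff_eq_0)
  then show ?thesis
    by (simp add: residue_poly_def coeff_sum coeff_P_poly[simplified] sum_subtractf algebra_simps)
qed

text \<open>An arbitrary finite index type \<open>'a\<close> treats the solutions symmetrically; the
  theorem uses the type \<open>3\<close>. Independence is over constants and refers to all of
  \<open>U\<close>.\<close>

locale linear_system =
  fixes s1 s2 :: complex and s :: "'n::finite \<Rightarrow> complex" and U :: "(complex ^ 'n) set"
    and \<Phi> :: "'a::finite \<Rightarrow> complex ^ 'n \<Rightarrow> complex poly"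
  assumes open_U: "open U" and connected_U: "connected U" and nonempty_U: "U \<noteq> {}"
    and distinct: "u \<in> U \<Longrightarrow> inj (\<lambda>i. u $ i)"
    and neq_0: "u \<in> U \<Longrightarrow> u $ i \<noteq> 0" and neq_1: "u \<in> U \<Longrightarrow> u $ i \<noteq> 1"
    and solution: "solves_L s1 s2 s U (\<Phi> a)"
    and two_indices: "\<exists>a b :: 'a. a \<noteq> b"
    and independent: "(\<And>u. u \<in> U \<Longrightarrow> (\<Sum>b\<in>UNIV. smult (c b) (\<Phi> b u)) = 0) \<Longrightarrow> c a = 0"
    and nondegenerate: "nondegenerate s1 s2 s U (range \<Phi>)"
begin

lemma degree_le_n: "u \<in> U \<Longrightarrow> degree (\<Phi> a u) \<le> CARD('n)"
  using solution unfolding solves_L_def by blast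

lemma holomorphic_coeff: "holomorphic_vec (\<lambda>u. coeff (\<Phi> a u) k) U"
  using solution unfolding solves_L_def by blast

lemma nth_eq_iff: "u \<in> U \<Longrightarrow> u $ i = u $ j \<longleftrightarrow> i = j"
  using distinct by (metis injD)

lemma card_range_nth: "u \<in> U \<Longrightarrow> card ((\<lambda>i. u $ i) ` A) = card A"
  using distinct by (metis card_image inj_on_subset top_greatest)

lemma D_neq_0: "u \<in> U \<Longrightarrow> D i u \<noteq> 0"
  by (auto simp: D_def P_def neq_0 neq_1 nth_eq_iff)

lemma P_at_node: "u \<in> U \<Longrightarrow> P i (u $ j) u = (if i = j then D j u else 0)"
  by (auto simp: D_def P_def)

lemma residue_poly_at_node: "u \<in> U \<Longrightarrow> poly (residue_poly s1 s2 s u) (u $ j) = (s j - 1) * D j u"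
proof -
  assume u: "u \<in> U"
  have "poly (nodal_poly u) (u $ j) = 0" by (auto simp: poly_nodal_poly)
  moreover have "(\<Sum>m\<in>UNIV. (s m - 1) * P m (u $ j) u) = (\<Sum>m\<in>UNIV. if m = j then (s j - 1) * D j u else 0)"
    by (rule sum.cong) (auto simp: P_at_node[OF u])
  ultimately show ?thesis by (simp add: poly_residue_poly)
qed

text \<open>(L) multiplied by \<open>(x - u $ i) * D i u\<close>. The residue at
  \<open>u $ i\<close> in (L) is \<open>s i\<close> and not \<open>s i - 1\<close>, which accounts
  for the extra \<open>P_poly i u\<close>.\<close>

lemma linear_system_poly:
  assumes u: "u \<in> U"
  shows "[:- u $ i, 1:] * smult (D i u) (poly_partial i (\<Phi> a) u) =
    smult (poly (\<Phi> a u) (u $ i)) (residue_poly s1 s2 s u + P_poly i u) - smult (s i * D i u) (\<Phi> a u)"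
proof (rule poly_cofinite_eqI)
  show "finite ({0, 1} \<union> range (\<lambda>m. u $ m))" by simp
  fix x assume "x \<notin> {0, 1} \<union> range (\<lambda>m. u $ m)"
  then have x: "x \<noteq> 0" "x \<noteq> 1" "\<And>m. x - u $ m \<noteq> 0" by auto
  let ?R = "(s1 - 1) / x + (s2 - 1) / (x - 1) + s i / (x - u $ i) + (\<Sum>m\<in>UNIV - {i}. (s m - 1) / (x - u $ m))"
  have L: "poly (poly_partial i (\<Phi> a) u) x = poly (\<Phi> a u) (u $ i) * (P i x u / D i u) * ?R
      - s i / (x - u $ i) * poly (\<Phi> a u) x"
    using solution[of a] u x unfolding solves_L_def poly_partial_def
    by (simp add: poly_sum poly_monom)
  \<comment> \<open>Supplying \<open>P m x u\<close> with its missing factor gives the same product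
    \<open>N\<close> for every \<open>m\<close>; dividing \<open>N\<close> by the factor of each
    pole produces the terms of \<open>residue_poly\<close>.\<close>
  have M: "x * (x - 1) * poly (nodal_poly u) x = (x - u $ m) * P m x u" for m
    by (simp add: poly_nodal_poly P_def prod.remove[of UNIV m] algebra_simps)
  define N where "N = x * (x - 1) * poly (nodal_poly u) x"
  have Nm: "N / (x - u $ m) = P m x u" for m
    unfolding N_def M[of m] using x(3)[of m] by simp
  have N01: "N / x = (x - 1) * poly (nodal_poly u) x" "N / (x - 1) = x * poly (nodal_poly u) x"
    unfolding N_def using x by simp_all
  have "(x - u $ i) * P i x u * ?R = N * ?R"
    unfolding N_def M[of i] ..
  also have "\<dots> = (s1 - 1) * (N / x) + (s2 - 1) * (N / (x - 1)) + s i * (N / (x - u $ i))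
      + (\<Sum>m\<in>UNIV - {i}. (s m - 1) * (N / (x - u $ m)))"
    by (simp add: distrib_left sum_distrib_left mult.commute)
  also have "\<dots> = poly (residue_poly s1 s2 s u) x + P i x u"
    unfolding Nm N01 by (simp add: poly_residue_poly sum.remove[of UNIV i] algebra_simps)
  finally have R: "(x - u $ i) * P i x u * ?R = poly (residue_poly s1 s2 s u) x + P i x u" .
  have "(x - u $ i) * D i u * poly (poly_partial i (\<Phi> a) u) x =
      poly (\<Phi> a u) (u $ i) * ((x - u $ i) * P i x u * ?R) - s i * D i u * poly (\<Phi> a u) x"
    using x(3)[of i] D_neq_0[OF u, of i] unfolding L by (simp add: right_diff_distrib)
  then show "poly ([:- u $ i, 1:] * smult (D i u) (poly_partial i (\<Phi> a) u)) x =
      poly (smult (poly (\<Phi> a u) (u $ i)) (residue_poly s1 s2 s u + P_poly i u) - smult (s i * D i u) (\<Phi> a u)) x"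
    unfolding R by (simp add: poly_P_poly algebra_simps)
qed

lemma linear_system_eval:
  assumes "u \<in> U"
  shows "(x - u $ i) * D i u * poly (poly_partial i (\<Phi> a) u) x =
    poly (\<Phi> a u) (u $ i) * (poly (residue_poly s1 s2 s u) x + P i x u) - s i * D i u * poly (\<Phi> a u) x"
  using arg_cong[OF linear_system_poly[OF assms, of i a], of "\<lambda>p. poly p x"]
  by (simp add: poly_P_poly algebra_simps)

lemma has_field_derivative_eval:
  assumes u: "u \<in> U"
  shows "((\<lambda>t. poly (\<Phi> a (coordinate_line i u t)) c) has_field_derivative
    poly (poly_partial i (\<Phi> a) u) c) (at (u $ i))"
proof -
  have "((\<lambda>t. \<Sum>k\<le>CARD('n). coeff (\<Phi> a (coordinate_line i u t)) k * c ^ k) has_field_derivative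
     (\<Sum>k\<le>CARD('n). partial_deriv i (\<lambda>v. coeff (\<Phi> a v) k) u * c ^ k)) (at (u $ i))"
    unfolding coordinate_line_def
    by (intro DERIV_sum DERIV_cmult_right holomorphic_vec_partial[OF holomorphic_coeff u])
  then have "((\<lambda>t. \<Sum>k\<le>CARD('n). coeff (\<Phi> a (coordinate_line i u t)) k * c ^ k) has_field_derivative
     poly (poly_partial i (\<Phi> a) u) c) (at (u $ i))"
    by (simp add: poly_partial_def poly_sum poly_monom)
  then show ?thesis
    by (rule has_field_derivative_transform_within_open[OF _ open_coordinate_line[OF open_U, of i u]])
      (use u in \<open>auto intro: sum_coeff_eq_poly degree_le_n\<close>)
qed

text \<open>The root is assumed only along the coordinate line in direction \<open>i\<close>, so
  \<open>c\<close> may be another coordinate \<open>u $ j\<close>, which is constant there.\<close>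

lemma poly_partial_eq_0:
  assumes "open O'" "O' \<subseteq> U" "u \<in> O'" "\<And>t. coordinate_line i u t \<in> O' \<Longrightarrow> poly (\<Phi> a (coordinate_line i u t)) c = 0"
  shows "poly (poly_partial i (\<Phi> a) u) c = 0"
proof -
  have "u \<in> U" using assms by blast
  have "((\<lambda>t. 0) has_field_derivative poly (poly_partial i (\<Phi> a) u) c) (at (u $ i))"
    by (rule has_field_derivative_transform_within_open[OF has_field_derivative_eval[OF \<open>u \<in> U\<close>]
          open_coordinate_line[OF assms(1), of i u]]) (use assms in auto)
  then show ?thesis using DERIV_unique DERIV_const by blast
qed

lemma holomorphic_eval:
  assumes "holomorphic_vec g U"
  shows "holomorphic_vec (\<lambda>u. poly (\<Phi> a u) (g u)) U"
  by (rule holomorphic_vec_cong[OF _ open_U sum_coeff_eq_poly[OF degree_le_n]])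
    (intro holomorphic_vec_sum holomorphic_vec_mult holomorphic_vec_power holomorphic_coeff assms)

section \<open>Linear independence on open subsets\<close>

lemma vanish_extend:
  assumes "open O'" "O' \<noteq> {}" "O' \<subseteq> U" and z: "\<And>u. u \<in> O' \<Longrightarrow> smult c (\<Phi> a u) + smult d (\<Phi> b u) = 0"
    and x: "x \<in> U"
  shows "smult c (\<Phi> a x) + smult d (\<Phi> b x) = 0"
proof (rule poly_eqI)
  fix k
  have "c * coeff (\<Phi> a x) k + d * coeff (\<Phi> b x) k = 0"
    by (rule holomorphic_vec_identity[OF _ open_U connected_U assms(1-3) _ x])
      (use z in \<open>auto intro!: holomorphic_vec_add holomorphic_vec_mult holomorphic_coeff simp: poly_eq_iff\<close>)
  then show "coeff (smult c (\<Phi> a x) + smult d (\<Phi> b x)) k = coeff 0 k" by simp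
qed

text \<open>The identity theorem, applied to each coefficient, extends a relation from an open
  subset to \<open>U\<close>; padding with zeros makes it a relation of the whole tuple.\<close>

lemma not_dependent:
  assumes O: "open O'" "O' \<noteq> {}" "O' \<subseteq> U" and "a \<noteq> b"
    and z: "\<And>u. u \<in> O' \<Longrightarrow> smult c (\<Phi> a u) + smult d (\<Phi> b u) = 0"
  shows "c = 0"
proof -
  define e where "e = (\<lambda>x. if x = a then c else if x = b then d else 0)"
  have "e a = 0"
  proof (rule independent)
    fix u assume u: "u \<in> U"
    have "(\<Sum>x\<in>UNIV. smult (e x) (\<Phi> x u)) = (\<Sum>x\<in>{a, b}. smult (e x) (\<Phi> x u))"
      by (rule sum.mono_neutral_right) (auto simp: e_def)
    also have "\<dots> = 0" using \<open>a \<noteq> b\<close> vanish_extend[OF O z u] by (simp add: e_def)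
    finally show "(\<Sum>x\<in>UNIV. smult (e x) (\<Phi> x u)) = 0" .
  qed
  then show ?thesis by (simp add: e_def)
qed

text \<open>On a ball where a coefficient of \<open>\<Phi> a\<close> has no zero,
  \<open>\<Phi> b\<close> is a holomorphic factor times \<open>\<Phi> a\<close>. At a fixed point
  (L) expresses the derivative linearly through the solution, so the factor has zero derivative and
  is constant, against independence.\<close>

lemma not_proportional:
  assumes O: "open O'" "O' \<noteq> {}" "O' \<subseteq> U"
  shows "\<exists>u\<in>O'. \<not> proportional (\<lambda>a. \<Phi> a u)"
proof (rule ccontr)
  assume "\<not> ?thesis"
  then have prp: "proportional (\<lambda>a. \<Phi> a u)" if "u \<in> O'" for u using that by blast
  obtain a b :: 'a where ab: "a \<noteq> b" using two_indices by blast
  have "\<exists>u\<in>O'. \<Phi> a u \<noteq> 0" using not_dependent[OF O ab, of 1 0] by auto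
  then obtain u1 k where u1: "u1 \<in> O'" "coeff (\<Phi> a u1) k \<noteq> 0"
    using leading_coeff_0_iff by blast
  define A where "A u = coeff (\<Phi> a u) k" for u
  define B where "B u = coeff (\<Phi> b u) k" for u
  have hA: "holomorphic_vec A U" and hB: "holomorphic_vec B U"
    unfolding A_def B_def by (rule holomorphic_coeff)+
  have "open (O' \<inter> A -` (- {0}))"
    using holomorphic_vec_continuous_on[OF holomorphic_vec_subset[OF hA O(3)]] O(1)
    by (intro continuous_open_preimage) auto
  moreover have "u1 \<in> O' \<inter> A -` (- {0})" using u1 by (simp add: A_def)
  ultimately obtain r where r: "r > 0" "ball u1 r \<subseteq> O' \<inter> A -` (- {0})"
    using openE by blast
  have ballU: "ball u1 r \<subseteq> U" using r O(3) by auto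
  have A0: "A u \<noteq> 0" if "u \<in> ball u1 r" for u
    using r that by auto
  have hq: "holomorphic_vec (\<lambda>u. B u / A u) (ball u1 r)"
    using ballU r(1) A0 by (intro holomorphic_vec_divide holomorphic_vec_subset[OF hA] holomorphic_vec_subset[OF hB]) auto
  have eq: "\<Phi> b u = smult (B u / A u) (\<Phi> a u)" if u: "u \<in> ball u1 r" for u
  proof -
    have "smult (B u) (\<Phi> a u) = smult (A u) (\<Phi> b u)"
      unfolding A_def B_def using proportional_smult[OF prp[of u], of b k a] u r(2) by auto
    then have "smult (inverse (A u)) (smult (B u) (\<Phi> a u)) = smult (inverse (A u)) (smult (A u) (\<Phi> b u))" by simp
    then show ?thesis using A0[OF u] by (simp add: divide_inverse mult.commute)
  qed
  have zero: "partial_deriv i (\<lambda>u. B u / A u) u = 0" if u: "u \<in> ball u1 r" for u i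
  proof -
    have uU: "u \<in> U" using u ballU r(1) by auto
    define q where "q = B u / A u"
    have ev: "poly (\<Phi> b u) x = q * poly (\<Phi> a u) x" for x
      using eq[OF u] by (simp add: q_def)
    have "[:- u $ i, 1:] * smult (D i u) (poly_partial i (\<Phi> b) u) =
        smult q ([:- u $ i, 1:] * smult (D i u) (poly_partial i (\<Phi> a) u))"
      unfolding linear_system_poly[OF uU] ev using eq[OF u]
      by (simp add: q_def smult_diff_right smult_add_right algebra_simps)
    then have "[:- u $ i, 1:] * smult (D i u) (poly_partial i (\<Phi> b) u) =
        [:- u $ i, 1:] * smult (D i u) (smult q (poly_partial i (\<Phi> a) u))"
      by (simp only: mult_smult_right smult_smult mult.commute)
    then have p: "poly_partial i (\<Phi> b) u = smult q (poly_partial i (\<Phi> a) u)"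
      using D_neq_0[OF uU, of i] by (subst (asm) mult_left_cancel) (auto simp: smult_cancel simp del: smult_smult)
    \<comment> \<open>\<open>poly_partial\<close> carries coefficients only up to this index, so
      \<open>k\<close> must lie in the range before coefficients are compared.\<close>
    have "k \<le> CARD('n)" using u1 O(3) degree_le_n[of u1 a] le_degree[of "\<Phi> a u1" k] by auto
    then have dB: "partial_deriv i B u = q * partial_deriv i A u"
      using arg_cong[OF p, of "\<lambda>p. coeff p k"]
      by (simp add: poly_partial_def coeff_sum A_def[abs_def] B_def[abs_def])
    have "((\<lambda>t. B (\<chi> j. if j = i then t else u $ j) / A (\<chi> j. if j = i then t else u $ j)) has_field_derivative
        (partial_deriv i B u * A u - B u * partial_deriv i A u) / (A u * A u)) (at (u $ i))"
      using DERIV_divide[OF holomorphic_vec_partial[OF hB uU, of i] holomorphic_vec_partial[OF hA uU, of i]]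
        A0[OF u] coordinate_line_self[of i u, unfolded coordinate_line_def] by simp
    moreover have "(partial_deriv i B u * A u - B u * partial_deriv i A u) / (A u * A u) = 0"
      using A0[OF u] by (simp add: dB q_def)
    ultimately show ?thesis
      unfolding partial_deriv_def by (intro DERIV_imp_deriv) simp
  qed
  define q where "q = B u1 / A u1"
  have "\<Phi> b u = smult q (\<Phi> a u)" if u: "u \<in> ball u1 r" for u
    using eq[OF u] holomorphic_vec_constant_ball[OF hq zero u] by (simp add: q_def)
  then have "(1::complex) = 0"
    using r(1) ballU by (intro not_dependent[of "ball u1 r" b a 1 "- q"]) (use ab in auto)
  then show False by simp
qed

text \<open>A polynomial of degree at most \<open>CARD('n)\<close> vanishing at all the
  \<open>u $ i\<close> is determined by its coefficient of index \<open>CARD('n)\<close>, so the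
  tuple would be proportional on \<open>O'\<close>.\<close>

lemma not_all_vanish_at_nodes:
  assumes O: "open O'" "O' \<noteq> {}" "O' \<subseteq> U"
  shows "\<exists>u\<in>O'. \<exists>a i. poly (\<Phi> a u) (u $ i) \<noteq> 0"
proof (rule ccontr)
  assume "\<not> ?thesis"
  then have z: "poly (\<Phi> a u) (u $ i) = 0" if "u \<in> O'" for u a i using that by blast
  have "proportional (\<lambda>a. \<Phi> a u)" if u: "u \<in> O'" for u
  proof -
    have uU: "u \<in> U" using u O by blast
    have lin: "smult (coeff (\<Phi> b u) CARD('n)) (\<Phi> a u) = smult (coeff (\<Phi> a u) CARD('n)) (\<Phi> b u)" for a b
    proof -
      let ?p = "smult (coeff (\<Phi> b u) CARD('n)) (\<Phi> a u) - smult (coeff (\<Phi> a u) CARD('n)) (\<Phi> b u)"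
      have "degree ?p \<le> CARD('n)" using degree_le_n[OF uU]
        by (auto intro!: degree_diff_le order_trans[OF degree_smult_le])
      moreover have "coeff ?p CARD('n) = 0" by simp
      moreover have "CARD('n) > 0" by simp
      ultimately have "degree ?p < CARD('n)"
        by (metis le_neq_implies_less leading_coeff_0_iff degree_0)
      then have "?p = 0"
        by (intro poly_eq_0_if_many_roots[of "range (\<lambda>i. u $ i)"])
          (auto simp: card_range_nth[OF uU] z[OF u])
      then show ?thesis by simp
    qed
    show ?thesis
    \<comment> \<open>The top coefficients form a reduction of degree 0 unless all are zero; in that
      case the roots outnumber the degree and the whole tuple is zero.\<close>
    proof (cases "\<forall>a. coeff (\<Phi> a u) CARD('n) = 0")
      case True
      have "\<Phi> a u = 0" for a
      proof -
        have "CARD('n) > 0" by simp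
        then have "degree (\<Phi> a u) < CARD('n)" 
          using True degree_le_n[OF uU, of a] by (metis le_neq_implies_less leading_coeff_0_iff degree_0)
        then show ?thesis
          by (intro poly_eq_0_if_many_roots[of "range (\<lambda>i. u $ i)"])
            (auto simp: card_range_nth[OF uU] z[OF u])
      qed
      then show ?thesis by (simp add: proportional_def)
    next
      case False
      then obtain c where c: "coeff (\<Phi> c u) CARD('n) \<noteq> 0" by blast
      have "reduces_to 0 (\<lambda>a. \<Phi> a u)"
        unfolding reduces_to_def using c lin
        by (intro exI[of _ "\<lambda>a. [:coeff (\<Phi> a u) CARD('n):]"]) auto
      then show ?thesis by (rule reduces_to_0_imp_proportional)
    qed
  qed
  then show False using not_proportional[OF O] by blast
qed

section \<open>Exclusion of common roots at 0, 1, the nodes and infinity\<close>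

text \<open>If all solutions vanished at 0, then (L) at 0 would reduce to
  \<open>poly (\<Phi> a u) (u $ i)\<close> times a nonzero multiple of \<open>s1 - 1\<close>. As
  \<open>s1 = 1\<close> is excluded by nondegeneracy, all values at the nodes would vanish.\<close>

lemma nonvanishing_0: "\<exists>a. \<exists>u\<in>U. poly (\<Phi> a u) 0 \<noteq> 0"
proof (rule ccontr)
  assume "\<not> ?thesis"
  then have z: "poly (\<Phi> a u) 0 = 0" if "u \<in> U" for u a using that by blast
  then have s1: "s1 \<noteq> 1" using nondegenerate unfolding nondegenerate_def by auto
  have "poly (\<Phi> a u) (u $ i) = 0" if u: "u \<in> U" for u a i
  proof -
    have "poly (poly_partial i (\<Phi> a) u) 0 = 0"
      by (rule poly_partial_eq_0[OF open_U order_refl u z])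
    moreover have "poly (residue_poly s1 s2 s u) 0 \<noteq> 0"
      using s1 neq_0[OF u] by (auto simp: poly_residue_poly poly_nodal_poly P_def)
    ultimately show ?thesis
      using linear_system_eval[OF u, of 0 i a] z[OF u] by (simp add: P_def)
  qed
  then show False using not_all_vanish_at_nodes[OF open_U nonempty_U order_refl] by blast
qed

lemma nonvanishing_1: "\<exists>a. \<exists>u\<in>U. poly (\<Phi> a u) 1 \<noteq> 0"
proof (rule ccontr)
  assume "\<not> ?thesis"
  then have z: "poly (\<Phi> a u) 1 = 0" if "u \<in> U" for u a using that by blast
  then have s2: "s2 \<noteq> 1" using nondegenerate unfolding nondegenerate_def by auto
  have "poly (\<Phi> a u) (u $ i) = 0" if u: "u \<in> U" for u a i
  proof -
    have "poly (poly_partial i (\<Phi> a) u) 1 = 0"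
      by (rule poly_partial_eq_0[OF open_U order_refl u z])
    moreover have "poly (residue_poly s1 s2 s u) 1 \<noteq> 0"
      using s2 neq_1[OF u] by (auto simp: poly_residue_poly poly_nodal_poly P_def)
    ultimately show ?thesis
      using linear_system_eval[OF u, of 1 i a] z[OF u] by (simp add: P_def)
  qed
  then show False using not_all_vanish_at_nodes[OF open_U nonempty_U order_refl] by blast
qed

lemma nonvanishing_node: "\<exists>a. \<exists>u\<in>U. poly (\<Phi> a u) (u $ j) \<noteq> 0"
proof (rule ccontr)
  assume "\<not> ?thesis"
  then have z: "poly (\<Phi> a u) (u $ j) = 0" if "u \<in> U" for u a using that by blast
  then have sj: "s j \<noteq> 1" using nondegenerate unfolding nondegenerate_def by auto
  have "poly (\<Phi> a u) (u $ i) = 0" if u: "u \<in> U" for u a i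
  \<comment> \<open>For \<open>i = j\<close> the claim is the assumption. For
    \<open>i \<noteq> j\<close> the point \<open>u $ j\<close> stays fixed in direction
    \<open>i\<close>, and (L) there has the factor \<open>(s j - 1) * D j u\<close>.\<close>
  proof (cases "i = j")
    case False
    have "poly (poly_partial i (\<Phi> a) u) (u $ j) = 0"
      by (rule poly_partial_eq_0[OF open_U order_refl u]) (metis False z coordinate_line_nth)
    then show ?thesis
      using linear_system_eval[OF u, of "u $ j" i a] z[OF u] sj False D_neq_0[OF u]
      by (simp add: residue_poly_at_node[OF u] P_at_node[OF u])
  qed (use z u in simp)
  then show False using not_all_vanish_at_nodes[OF open_U nonempty_U order_refl] by blast
qed

text \<open>The analogue at infinity: instead of evaluating, the coefficients of index
  \<open>CARD('n) + 1\<close> are compared in \<open>linear_system_poly\<close>. The extra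
  \<open>P_poly i u\<close> shifts the sum of residues by 1, to the resonance excluded by
  nondegeneracy.\<close>

lemma nonvanishing_lead: "\<exists>a. \<exists>u\<in>U. coeff (\<Phi> a u) CARD('n) \<noteq> 0"
proof (rule ccontr)
  assume "\<not> ?thesis"
  then have z: "coeff (\<Phi> a u) CARD('n) = 0" if "u \<in> U" for u a using that by blast
  then have s: "s1 + s2 + (\<Sum>j\<in>UNIV. s j) \<noteq> of_nat (CARD('n) + 1)"
    using nondegenerate unfolding nondegenerate_def by auto
  have "poly (\<Phi> a u) (u $ i) = 0" if u: "u \<in> U" for u a i
  proof -
    have "partial_deriv i (\<lambda>v. coeff (\<Phi> a v) CARD('n)) u = 0"
    proof -
      have "((\<lambda>t. 0) has_field_derivative partial_deriv i (\<lambda>v. coeff (\<Phi> a v) CARD('n)) u) (at (u $ i))"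
        by (rule has_field_derivative_transform_within_open[OF holomorphic_vec_partial[OF holomorphic_coeff u]
            open_coordinate_line[OF open_U, of i u]]) (use u z in \<open>auto simp: coordinate_line_def[symmetric]\<close>)
      then show ?thesis using DERIV_unique DERIV_const by blast
    qed
    then have "coeff (poly_partial i (\<Phi> a) u) CARD('n) = 0" by (simp add: poly_partial_def coeff_sum)
    moreover have "coeff (poly_partial i (\<Phi> a) u) (Suc CARD('n)) = 0"
      by (simp add: poly_partial_def coeff_sum)
    ultimately have "coeff ([:- u $ i, 1:] * smult (D i u) (poly_partial i (\<Phi> a) u)) (CARD('n) + 1) = 0" by simp
    moreover have "coeff (\<Phi> a u) (CARD('n) + 1) = 0"
      using degree_le_n[OF u, of a] by (intro coeff_eq_0) simp
    ultimately have "poly (\<Phi> a u) (u $ i) * (coeff (residue_poly s1 s2 s u) (CARD('n) + 1) + coeff (P_poly i u) (CARD('n) + 1)) = 0"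
      unfolding linear_system_poly[OF u] by (simp add: algebra_simps)
    then have "poly (\<Phi> a u) (u $ i) *
       (s1 + s2 + (\<Sum>m\<in>UNIV. s m) - of_nat (CARD('n) + 2) + 1) = 0"
      unfolding coeff_residue_poly coeff_P_poly by simp
    moreover have "s1 + s2 + (\<Sum>m\<in>UNIV. s m) - of_nat (CARD('n) + 2) + 1 \<noteq> 0"
      using s by (simp add: algebra_simps)
    ultimately show ?thesis by simp
  qed
  then show False using not_all_vanish_at_nodes[OF open_U nonempty_U order_refl] by blast
qed

text \<open>One solution that does not vanish identically is fixed for each special point; this
  leaves finitely many holomorphic functions whose zeros are to be avoided.\<close>

lemma generic_subset:
  assumes O: "open O'" "O' \<noteq> {}" "O' \<subseteq> U"
  obtains V where "open V" "V \<noteq> {}" "V \<subseteq> O'"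
    "\<And>u. u \<in> V \<Longrightarrow> \<exists>a. coeff (\<Phi> a u) CARD('n) \<noteq> 0" "\<And>u. u \<in> V \<Longrightarrow> \<exists>a. poly (\<Phi> a u) 0 \<noteq> 0"
    "\<And>u. u \<in> V \<Longrightarrow> \<exists>a. poly (\<Phi> a u) 1 \<noteq> 0" "\<And>u j. u \<in> V \<Longrightarrow> \<exists>a. poly (\<Phi> a u) (u $ j) \<noteq> 0"
proof -
  obtain a0 a1 a2 where a: "\<exists>u\<in>U. coeff (\<Phi> a0 u) CARD('n) \<noteq> 0" "\<exists>u\<in>U. poly (\<Phi> a1 u) 0 \<noteq> 0"
    "\<exists>u\<in>U. poly (\<Phi> a2 u) 1 \<noteq> 0"
    using nonvanishing_lead nonvanishing_0 nonvanishing_1 by blast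
  obtain b where b: "\<And>j. \<exists>u\<in>U. poly (\<Phi> (b j) u) (u $ j) \<noteq> 0"
    using nonvanishing_node by metis
  define S where "S = {\<lambda>u. coeff (\<Phi> a0 u) CARD('n), \<lambda>u. poly (\<Phi> a1 u) 0, \<lambda>u. poly (\<Phi> a2 u) 1} \<union>
     range (\<lambda>j u. poly (\<Phi> (b j) u) (u $ j))"
  have "finite S" by (simp add: S_def)
  moreover have "holomorphic_vec f U \<and> (\<exists>u\<in>U. f u \<noteq> 0)" if "f \<in> S" for f
    using that a b by (auto simp: S_def intro: holomorphic_coeff holomorphic_eval)
  ultimately have "\<exists>V. open V \<and> V \<noteq> {} \<and> V \<subseteq> O' \<and> (\<forall>u\<in>V. \<forall>f\<in>S. f u \<noteq> 0)"
    by (rule finite_avoid_zeros[OF _ open_U connected_U O])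
  then obtain V where V: "open V" "V \<noteq> {}" "V \<subseteq> O'" "\<And>u f. u \<in> V \<Longrightarrow> f \<in> S \<Longrightarrow> f u \<noteq> 0"
    by blast
  show ?thesis
  proof (rule that[OF V(1-3)])
    fix u j assume u: "u \<in> V"
    show "\<exists>a. coeff (\<Phi> a u) CARD('n) \<noteq> 0" using V(4)[OF u, of "\<lambda>u. coeff (\<Phi> a0 u) CARD('n)"] by (auto simp: S_def)
    show "\<exists>a. poly (\<Phi> a u) 0 \<noteq> 0" using V(4)[OF u, of "\<lambda>u. poly (\<Phi> a1 u) 0"] by (auto simp: S_def)
    show "\<exists>a. poly (\<Phi> a u) 1 \<noteq> 0" using V(4)[OF u, of "\<lambda>u. poly (\<Phi> a2 u) 1"] by (auto simp: S_def)
    show "\<exists>a. poly (\<Phi> a u) (u $ j) \<noteq> 0" using V(4)[OF u, of "\<lambda>u. poly (\<Phi> (b j) u) (u $ j)"] by (auto simp: S_def)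
  qed
qed

section \<open>Reducibility as a closed condition\<close>

text \<open>A common zero at infinity: the tuple is its own reduction. If it is zero altogether, any
  nonzero tuple of constants serves.\<close>

lemma reduces_to_lead_0:
  assumes u: "u \<in> U" "\<And>a. coeff (\<Phi> a u) CARD('n) = 0"
  shows "reduces_to (CARD('n) - 1) (\<lambda>a. \<Phi> a u)"
proof (cases "\<forall>a. \<Phi> a u = 0")
  case True
  then show ?thesis unfolding reduces_to_def by (intro exI[of _ "\<lambda>_. 1"]) auto
next
  case False
  have "degree (\<Phi> a u) \<le> CARD('n) - 1" for a
  proof (rule degree_le, intro allI impI)
    fix i assume "CARD('n) - 1 < i"
    then have "i = CARD('n) \<or> degree (\<Phi> a u) < i" using degree_le_n[OF u(1), of a] by linarith
    then show "coeff (\<Phi> a u) i = 0" using u(2) coeff_eq_0 by blast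
  qed
  with False show ?thesis unfolding reduces_to_def
    by (intro exI[of _ "\<lambda>a. \<Phi> a u"]) (auto simp: mult.commute)
qed

lemma reduces_to_closed:
  assumes v: "\<And>k. v k \<in> U" "v \<longlonglongrightarrow> u" "u \<in> U" and red: "\<And>k. reduces_to m (\<lambda>a. \<Phi> a (v k))"
  obtains r \<psi> \<psi>' where "strict_mono (r :: nat \<Rightarrow> nat)"
    "\<And>k a b. \<Phi> a (v (r k)) * \<psi> k b = \<Phi> b (v (r k)) * \<psi> k a" "\<And>k a. degree (\<psi> k a) \<le> m"
    "\<And>a. degree (\<psi>' a) \<le> m" "\<exists>a. \<psi>' a \<noteq> 0" "\<And>a b. \<Phi> a u * \<psi>' b = \<Phi> b u * \<psi>' a"
    "\<And>a x. (\<lambda>k. poly (\<psi> k a) x) \<longlonglongrightarrow> poly (\<psi>' a) x"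
proof -
  have lim: "(\<lambda>k. coeff (\<Phi> a (v k)) l) \<longlonglongrightarrow> coeff (\<Phi> a u) l" for a l
    using continuous_on_tendsto_compose[OF holomorphic_vec_continuous_on[OF holomorphic_coeff] v(2,3)] v(1)
    by simp
  obtain r \<psi> \<psi>' where r: "strict_mono (r :: nat \<Rightarrow> nat)"
    "\<And>k a b. \<Phi> a (v (r k)) * \<psi> k b = \<Phi> b (v (r k)) * \<psi> k a" "\<And>k a. degree (\<psi> k a) \<le> m"
    "\<And>a. degree (\<psi>' a) \<le> m" "\<exists>a. \<psi>' a \<noteq> 0" "\<And>a b. \<Phi> a u * \<psi>' b = \<Phi> b u * \<psi>' a"
    "\<And>a l. (\<lambda>k. coeff (\<psi> k a) l) \<longlonglongrightarrow> coeff (\<psi>' a) l"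
    using reduces_to_limit[where \<Phi> = "\<lambda>k a. \<Phi> a (v k)" and \<Phi>' = "\<lambda>a. \<Phi> a u" and m = m, OF red lim] by metis
  show ?thesis
    by (rule that[OF r(1-6) tendsto_poly_coeff[OF r(7,3,4)]])
qed

lemma open_irreducible: "open {u \<in> U. \<not> reduces_to m (\<lambda>a. \<Phi> a u)}"
proof -
  have "closedin (top_of_set U) {u \<in> U. reduces_to m (\<lambda>a. \<Phi> a u)}"
    unfolding closedin_limpt
  proof (intro conjI allI impI)
    fix u assume u: "u islimpt {u \<in> U. reduces_to m (\<lambda>a. \<Phi> a u)} \<and> u \<in> U"
    then obtain v where v: "\<And>k. v k \<in> {u \<in> U. reduces_to m (\<lambda>a. \<Phi> a u)}" "v \<longlonglongrightarrow> u"
      unfolding islimpt_sequential by blast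
    obtain \<psi>' where "\<And>a. degree (\<psi>' a) \<le> m" "\<exists>a. \<psi>' a \<noteq> 0" "\<And>a b. \<Phi> a u * \<psi>' b = \<Phi> b u * \<psi>' a"
      by (rule reduces_to_closed[of v u m]) (use u v in auto)
    then show "u \<in> {u \<in> U. reduces_to m (\<lambda>a. \<Phi> a u)}"
      using u unfolding reduces_to_def by blast
  qed auto
  then have "openin (top_of_set U) (U - {u \<in> U. reduces_to m (\<lambda>a. \<Phi> a u)})"
    by (simp add: openin_diff)
  then have "open (U - {u \<in> U. reduces_to m (\<lambda>a. \<Phi> a u)})"
    using open_U openin_open_trans by blast
  moreover have "U - {u \<in> U. reduces_to m (\<lambda>a. \<Phi> a u)} = {u \<in> U. \<not> reduces_to m (\<lambda>a. \<Phi> a u)}" by blast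
  ultimately show ?thesis by simp
qed

text \<open>The reductions at \<open>u\<close> displaced in the direction \<open>i\<close> converge to a multiple of the minimal one
  at \<open>u\<close>; dividing their relations by the displacement differentiates the common root without a
  choice of a branch of it.\<close>

lemma derivative_at_common_root:
  assumes V: "open V" "V \<subseteq> U" "u \<in> V" and red: "\<And>v. v \<in> V \<Longrightarrow> reduces_to m (\<lambda>a. \<Phi> a v)"
    and min: "\<And>m'. m' < m \<Longrightarrow> \<not> reduces_to m' (\<lambda>a. \<Phi> a u)"
    and \<psi>: "\<And>a b. \<Phi> a u * \<psi> b = \<Phi> b u * \<psi> a" and nz: "\<exists>a. \<Phi> a u \<noteq> 0"
    and root: "\<And>a. poly (\<Phi> a u) c = 0"
  shows "poly (poly_partial i (\<Phi> a) u) c * poly (\<psi> b) c = poly (poly_partial i (\<Phi> b) u) c * poly (\<psi> a) c"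
proof -
  have uU: "u \<in> U" using V by blast
  have "open {t. coordinate_line i u t \<in> V}" "u $ i \<in> {t. coordinate_line i u t \<in> V}"
    using V open_coordinate_line by auto
  then obtain e where e: "e > 0" "ball (u $ i) e \<subseteq> {t. coordinate_line i u t \<in> V}"
    using openE by blast
  \<comment> \<open>The offset 2 keeps the displacement strictly below \<open>e\<close> already for
    \<open>k = 0\<close>.\<close>
  define t where "t k = u $ i + of_real (e / real (k + 2))" for k
  have tV: "coordinate_line i u (t k) \<in> V" for k
  proof -
    have "dist (u $ i) (t k) = e / real (k + 2)"
      using e(1) by (simp add: t_def dist_norm del: of_real_divide)
    moreover have "e / real (k + 2) < e" using e(1) by (simp add: divide_less_eq)
    ultimately have "t k \<in> ball (u $ i) e" by simp
    then show ?thesis using e(2) by blast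
  qed
  have "(\<lambda>k. e / real (k + 2)) \<longlonglongrightarrow> 0" using LIMSEQ_ignore_initial_segment[OF lim_const_over_n[of e], of 2] .
  then have "(\<lambda>k. u $ i + of_real (e / real (k + 2))) \<longlonglongrightarrow> u $ i + of_real 0"
    by (intro tendsto_intros)
  then have t: "t \<longlonglongrightarrow> u $ i" by (simp add: t_def[abs_def])
  have t_neq: "t k \<noteq> u $ i" for k
    using e(1) by (simp add: t_def del: of_real_divide)
  have lim: "(\<lambda>k. coordinate_line i u (t k)) \<longlonglongrightarrow> u"
    using continuous_on_tendsto_compose[OF continuous_on_coordinate_line[of i u] t] by simp
  obtain r \<xi> \<xi>' where r: "strict_mono (r :: nat \<Rightarrow> nat)"
    "\<And>k a b. \<Phi> a (coordinate_line i u (t (r k))) * \<xi> k b = \<Phi> b (coordinate_line i u (t (r k))) * \<xi> k a"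
    "\<And>a. degree (\<xi>' a) \<le> m" "\<exists>a. \<xi>' a \<noteq> 0" "\<And>a b. \<Phi> a u * \<xi>' b = \<Phi> b u * \<xi>' a"
    "\<And>a x. (\<lambda>k. poly (\<xi> k a) x) \<longlonglongrightarrow> poly (\<xi>' a) x"
    by (rule reduces_to_closed[of "\<lambda>k. coordinate_line i u (t k)" u m])
      (use tV V uU lim red in auto)
  let ?d = "\<lambda>a. poly (poly_partial i (\<Phi> a) u) c"
  let ?q = "\<lambda>a k. poly (\<Phi> a (coordinate_line i u (t (r k)))) c / (t (r k) - u $ i)"
  \<comment> \<open>Since \<open>c\<close> is a root of \<open>\<Phi> a u\<close>, this is the
    difference quotient of the value at \<open>c\<close>.\<close>
  have q: "?q a \<longlonglongrightarrow> ?d a" for a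
  proof -
    have "((\<lambda>x. poly (\<Phi> a (coordinate_line i u x)) c / (x - u $ i)) \<longlongrightarrow> ?d a) (at (u $ i))"
      using has_field_derivative_eval[OF uU, of a i c] by (simp add: has_field_derivative_iff root)
    moreover have "filterlim (\<lambda>k. t (r k)) (at (u $ i)) sequentially"
      using LIMSEQ_subseq_LIMSEQ[OF t r(1)] t_neq by (simp add: filterlim_at o_def)
    ultimately show ?thesis by (rule filterlim_compose)
  qed
  have d: "?d a * poly (\<xi>' b) c = ?d b * poly (\<xi>' a) c" for a b
  proof (rule LIMSEQ_unique)
    show "(\<lambda>k. ?q a k * poly (\<xi> k b) c) \<longlonglongrightarrow> ?d a * poly (\<xi>' b) c"
      by (intro tendsto_mult q r)
    have "?q a k * poly (\<xi> k b) c = ?q b k * poly (\<xi> k a) c" for k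
      using arg_cong[OF r(2)[of a k b], of "\<lambda>p. poly p c"] by simp
    then show "(\<lambda>k. ?q a k * poly (\<xi> k b) c) \<longlonglongrightarrow> ?d b * poly (\<xi>' a) c"
      using tendsto_mult[OF q[of b] r(6)[of a c]] by presburger
  qed
  obtain d where d0: "poly (\<xi>' d) c \<noteq> 0"
    using minimal_reduction_no_common_root[OF min r(3-5)] by blast
  obtain e where e0: "\<Phi> e u \<noteq> 0" using nz by blast
  \<comment> \<open>Two reductions of the same nonzero tuple are proportional: both are compared
    through a nonzero \<open>\<Phi> e u\<close>, which is then cancelled.\<close>
  have "\<Phi> e u * \<Phi> e u * (\<psi> a * \<xi>' d) = \<Phi> e u * \<Phi> e u * (\<psi> d * \<xi>' a)" for a
  proof -
    have "\<Phi> e u * \<Phi> e u * (\<psi> a * \<xi>' d) = (\<Phi> e u * \<psi> a) * (\<Phi> e u * \<xi>' d)" by (simp only: mult_ac)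
    also have "\<dots> = (\<Phi> a u * \<psi> e) * (\<Phi> d u * \<xi>' e)" unfolding \<psi>[of e a] r(5)[of e d] ..
    also have "\<dots> = (\<Phi> d u * \<psi> e) * (\<Phi> a u * \<xi>' e)" by (simp only: mult_ac)
    also have "\<dots> = (\<Phi> e u * \<psi> d) * (\<Phi> e u * \<xi>' a)" unfolding \<psi>[of d e] r(5)[of a e] ..
    finally show ?thesis by (simp only: mult_ac)
  qed
  then have "\<psi> a * \<xi>' d = \<psi> d * \<xi>' a" for a using e0 by simp
  from arg_cong[OF this, of "\<lambda>p. poly p c"]
  \<comment> \<open>The factor does not depend on \<open>a\<close>, so the identity obtained for the
    limit \<open>\<xi>'\<close> carries over to \<open>\<psi>\<close>.\<close>
  have k: "poly (\<psi> a) c = poly (\<psi> d) c / poly (\<xi>' d) c * poly (\<xi>' a) c" for a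
    using d0 by (simp add: field_simps)
  show ?thesis using d[of a b] unfolding k[of a] k[of b] by simp
qed

section \<open>Irreducibility at generic points\<close>

lemma exists_irreducible:
  assumes O: "open O'" "O' \<noteq> {}" "O' \<subseteq> U"
  shows "\<exists>u\<in>O'. \<not> reduces_to (CARD('n) - 1) (\<lambda>a. \<Phi> a u)"
proof (rule ccontr)
  assume "\<not> ?thesis"
  then have red: "reduces_to (CARD('n) - 1) (\<lambda>a. \<Phi> a u)" if "u \<in> O'" for u using that by blast
  obtain V where V: "open V" "V \<noteq> {}" "V \<subseteq> O'"
    and gen: "\<And>u. u \<in> V \<Longrightarrow> \<exists>a. coeff (\<Phi> a u) CARD('n) \<noteq> 0" "\<And>u. u \<in> V \<Longrightarrow> \<exists>a. poly (\<Phi> a u) 0 \<noteq> 0"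
      "\<And>u. u \<in> V \<Longrightarrow> \<exists>a. poly (\<Phi> a u) 1 \<noteq> 0" "\<And>u j. u \<in> V \<Longrightarrow> \<exists>a. poly (\<Phi> a u) (u $ j) \<noteq> 0"
    using generic_subset[OF O] by metis
  \<comment> \<open>The least degree of a reduction. At a point \<open>u\<close> where it is maximal
    on \<open>V\<close>, reductions of degree \<open>\<delta> u\<close> exist throughout
    \<open>V\<close> and are minimal at \<open>u\<close>, as
    \<open>derivative_at_common_root\<close> requires.\<close>
  define \<delta> where "\<delta> u = (LEAST m. reduces_to m (\<lambda>a. \<Phi> a u))" for u
  have \<delta>: "reduces_to (\<delta> u) (\<lambda>a. \<Phi> a u)" "\<delta> u \<le> CARD('n) - 1" if "u \<in> V" for u
  proof -
    have "reduces_to (CARD('n) - 1) (\<lambda>a. \<Phi> a u)" using red that V(3) by blast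
    then show "reduces_to (\<delta> u) (\<lambda>a. \<Phi> a u)" "\<delta> u \<le> CARD('n) - 1"
      unfolding \<delta>_def by (rule LeastI, rule Least_le)
  qed
  have \<delta>_min: "\<not> reduces_to m (\<lambda>a. \<Phi> a u)" if "m < \<delta> u" for m u
    using not_less_Least[of m "\<lambda>m. reduces_to m (\<lambda>a. \<Phi> a u)"] that unfolding \<delta>_def by simp
  have fin: "finite (\<delta> ` V)" by (rule finite_subset[of _ "{..CARD('n) - 1}"]) (use \<delta>(2) in auto)
  then have "Max (\<delta> ` V) \<in> \<delta> ` V" using V(2) by (intro Max_in) auto
  then obtain u where u: "u \<in> V" "\<delta> u = Max (\<delta> ` V)" by auto
  have max: "\<delta> v \<le> \<delta> u" if "v \<in> V" for v using u(2) fin that by simp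
  have uU: "u \<in> U" using u V O by blast
  obtain \<psi> where \<psi>: "\<And>a. degree (\<psi> a) \<le> \<delta> u" "\<exists>a. \<psi> a \<noteq> 0" "\<And>a b. \<Phi> a u * \<psi> b = \<Phi> b u * \<psi> a"
    using \<delta>(1)[OF u(1)] unfolding reduces_to_def by blast
  have noroot: "\<exists>a. poly (\<psi> a) x \<noteq> 0" for x
    by (rule minimal_reduction_no_common_root[OF \<delta>_min \<psi>])
  \<comment> \<open>A solution of exact degree \<open>CARD('n)\<close> has no zero at infinity, so
    the drop in degree comes from a finite common root.\<close>
  obtain a0 where a0: "coeff (\<Phi> a0 u) CARD('n) \<noteq> 0" using gen(1)[OF u(1)] by blast
  have "CARD('n) \<le> degree (\<Phi> a0 u)" using a0 by (rule le_degree)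
  moreover have "CARD('n) > 0" by simp
  ultimately have "degree (\<psi> a0) < degree (\<Phi> a0 u)"
    using \<psi>(1)[of a0] \<delta>(2)[OF u(1)] by linarith
  then obtain c where c: "\<And>a. poly (\<Phi> a u) c = 0"
    using common_root_of_reduction[of "\<lambda>a. \<Phi> a u" \<psi>, OF \<psi>(3) noroot] by blast
  have c01: "c \<noteq> 0" "c \<noteq> 1" and cu: "c - u $ j \<noteq> 0" for j
    using gen(2,3)[OF u(1)] gen(4)[OF u(1), of j] c by auto
  \<comment> \<open>The factor of \<open>poly (\<Phi> a u) (u $ i)\<close> in (L) evaluated at the
    common root, where the other term on the right vanishes.\<close>
  define K where "K i = poly (residue_poly s1 s2 s u) c + P i c u" for i
  have K: "K i * (poly (\<Phi> a u) (u $ i) * poly (\<psi> b) c - poly (\<Phi> b u) (u $ i) * poly (\<psi> a) c) = 0" for i a b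
  proof -
    have L: "poly (\<Phi> a u) (u $ i) * K i = (c - u $ i) * D i u * poly (poly_partial i (\<Phi> a) u) c" for a
      using linear_system_eval[OF uU, of c i a] by (simp add: c K_def)
    have "poly (poly_partial i (\<Phi> a) u) c * poly (\<psi> b) c = poly (poly_partial i (\<Phi> b) u) c * poly (\<psi> a) c"
    proof (rule derivative_at_common_root[where m = "\<delta> u"])
      show "V \<subseteq> U" using V O by blast
      show "reduces_to (\<delta> u) (\<lambda>a. \<Phi> a v)" if "v \<in> V" for v
        using reduces_to_mono[OF \<delta>(1) max] that by blast
      show "\<exists>a. \<Phi> a u \<noteq> 0" using a0 by (intro exI[of _ a0]) auto
    qed (use V u \<delta>_min \<psi> c in auto)
    then have "(poly (\<Phi> a u) (u $ i) * K i) * poly (\<psi> b) c = (poly (\<Phi> b u) (u $ i) * K i) * poly (\<psi> a) c"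
      unfolding L by simp
    then show ?thesis by (simp add: algebra_simps)
  qed
  \<comment> \<open>The product \<open>(c - u $ i) * P i c u\<close> is the same for all
    \<open>i\<close>; if \<open>K i\<close> and \<open>K j\<close> both vanish, then
    \<open>P i c u = P j c u\<close>, hence \<open>u $ i = u $ j\<close>.\<close>
  have "\<exists>i0. \<forall>i. i \<noteq> i0 \<longrightarrow> K i \<noteq> 0"
  proof -
    have "i = j" if "K i = 0" "K j = 0" for i j
    proof -
      have M: "(c - u $ m) * P m c u = c * (c - 1) * poly (nodal_poly u) c" for m
        by (simp add: poly_nodal_poly P_def prod.remove[of UNIV m] algebra_simps)
      have "P i c u = P j c u" using that unfolding K_def by (metis add_left_cancel)
      then have "(c - u $ i) * P i c u = (c - u $ j) * P i c u" using M[of i] M[of j] by simp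
      moreover have "P i c u \<noteq> 0" using c01 cu by (simp add: P_def)
      ultimately show ?thesis using nth_eq_iff[OF uU] by simp
    qed
    then show ?thesis by metis
  qed
  then obtain i0 where i0: "\<And>i. i \<noteq> i0 \<Longrightarrow> K i \<noteq> 0" by blast
  have prop_u: "smult (poly (\<psi> b) c) (\<Phi> a u) = smult (poly (\<psi> a) c) (\<Phi> b u)" for a b
  proof -
    obtain d where d: "poly (\<psi> d) c \<noteq> 0" using noroot by blast
    let ?f = "smult (poly (\<psi> b) c) (\<Phi> a u) - smult (poly (\<psi> a) c) (\<Phi> b u)"
    have "?f = 0"
    \<comment> \<open>On the right both factors vanish at \<open>c\<close>:
      \<open>\<Phi> d u\<close> as a member of the tuple, the other by the choice of weights. The
      nodes other than \<open>u $ i0\<close> are further roots, by \<open>K\<close>.\<close>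
    proof (rule poly_double_root_eq_0)
      show "?f * \<psi> d = \<Phi> d u * (smult (poly (\<psi> b) c) (\<psi> a) - smult (poly (\<psi> a) c) (\<psi> b))"
        using \<psi>(3)[of a d] \<psi>(3)[of b d] by (simp add: left_diff_distrib right_diff_distrib)
      show "poly (\<psi> d) c \<noteq> 0" by fact
      show "c \<notin> (\<lambda>i. u $ i) ` (UNIV - {i0})" using cu by auto
      show "poly ?f x = 0" if "x \<in> (\<lambda>i. u $ i) ` (UNIV - {i0})" for x
      proof -
        obtain i where i: "x = u $ i" "i \<noteq> i0" using \<open>x \<in> _\<close> by auto
        show ?thesis using K[of i a b] i0[OF i(2)] by (simp add: i(1) mult.commute)
      qed
      have "degree ?f \<le> CARD('n)"
        using degree_le_n[OF uU] by (auto intro!: degree_diff_le order_trans[OF degree_smult_le])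
      then show "degree ?f \<le> card ((\<lambda>i. u $ i) ` (UNIV - {i0})) + 1"
        by (simp add: card_range_nth[OF uU])
    qed (use c in auto)
    then show ?thesis by simp
  qed
  \<comment> \<open>The constants \<open>poly (\<psi> a) c\<close> reduce the tuple to degree 0, so
    \<open>\<delta> u = 0\<close>. By maximality the tuple is proportional on all of
    \<open>V\<close>.\<close>
  have "reduces_to 0 (\<lambda>a. \<Phi> a u)"
    unfolding reduces_to_def
    by (intro exI[of _ "\<lambda>a. [:poly (\<psi> a) c:]"]) (use prop_u noroot in \<open>auto simp: mult.commute\<close>)
  then have "\<delta> u = 0" using \<delta>_min[of 0 u] by auto
  then have "proportional (\<lambda>a. \<Phi> a v)" if "v \<in> V" for v
    using \<delta>(1)[OF that] max[OF that] by (intro reduces_to_0_imp_proportional) simp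
  then show False using not_proportional[OF V(1,2)] V(3) O(3) by blast
qed

section \<open>Bezoutian coefficients as coefficients of the equations\<close>

lemma holomorphic_bez:
  "holomorphic_vec (\<lambda>u. poly (bez (\<Phi> a u) (\<Phi> b u) k) (u $ j) / D j u) U"
proof -
  have shift: "holomorphic_vec (\<lambda>u. poly (poly_shift (Suc k) (\<Phi> a u)) (u $ j)) U" for a
  proof (rule holomorphic_vec_cong[OF _ open_U sum_coeff_eq_poly])
    show "holomorphic_vec (\<lambda>u. \<Sum>l\<le>CARD('n). coeff (poly_shift (Suc k) (\<Phi> a u)) l * u $ j ^ l) U"
      unfolding coeff_poly_shift
      by (intro holomorphic_vec_sum holomorphic_vec_mult holomorphic_vec_power holomorphic_coeff holomorphic_vec_component)
    show "degree (poly_shift (Suc k) (\<Phi> a u)) \<le> CARD('n)" if "u \<in> U" for u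
      using degree_poly_shift_le[of "Suc k" "\<Phi> a u"] degree_le_n[OF that, of a] by linarith
  qed
  have "holomorphic_vec (\<lambda>u. D j u) U"
    unfolding D_def P_def
    by (intro holomorphic_vec_mult holomorphic_vec_prod holomorphic_vec_diff holomorphic_vec_component holomorphic_vec_const)
  then show ?thesis
    unfolding bez_def poly_diff poly_mult
    by (intro holomorphic_vec_divide holomorphic_vec_diff holomorphic_vec_mult shift holomorphic_eval
        holomorphic_vec_component D_neq_0)
qed

text \<open>The combination of the \<open>bez\<close> polynomials has degree below
  \<open>CARD('n)\<close> and vanishes at all nodes, so it is zero. This reads as the relation of a
  reduction by combinations of shifts. Irreducibility makes these zero, and the shifts of a solution
  of exact degree \<open>CARD('n)\<close> are independent.\<close>

lemma bez_coefficients_independent: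
  assumes u: "u \<in> U" and irr: "\<not> reduces_to (CARD('n) - 1) (\<lambda>a. \<Phi> a u)"
    and zero: "\<And>a b j. (\<Sum>k<CARD('n). \<rho> k * poly (bez (\<Phi> a u) (\<Phi> b u) k) (u $ j)) = 0"
    and k: "k < CARD('n)"
  shows "\<rho> k = 0"
proof -
  define \<psi> where "\<psi> a = (\<Sum>k<CARD('n). smult (\<rho> k) (poly_shift (Suc k) (\<Phi> a u)))" for a
  have pos: "CARD('n) > 0" by simp
  have rel: "\<Phi> a u * \<psi> b = \<Phi> b u * \<psi> a" for a b
  proof -
    let ?C = "\<Sum>k<CARD('n). smult (\<rho> k) (bez (\<Phi> a u) (\<Phi> b u) k)"
    have "?C = 0"
    proof (rule poly_eq_0_if_many_roots)
      have "degree ?C \<le> CARD('n) - 1"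
        by (intro degree_sum_le order_trans[OF degree_smult_le] degree_bez_le degree_le_n u) simp
      then show "degree ?C < card (range (\<lambda>i. u $ i))"
        unfolding card_range_nth[OF u] using pos by linarith
      show "poly ?C x = 0" if "x \<in> range (\<lambda>i. u $ i)" for x
        using that zero[of a b] by (auto simp: poly_sum)
    qed simp
    moreover have "?C = \<Phi> b u * \<psi> a - \<Phi> a u * \<psi> b"
      by (simp add: \<psi>_def bez_def sum_distrib_left smult_diff_right sum_subtractf)
    ultimately show ?thesis by simp
  qed
  have "degree (\<psi> a) \<le> CARD('n) - 1" for a
    unfolding \<psi>_def
  proof (intro degree_sum_le order_trans[OF degree_smult_le])
    fix k
    show "degree (poly_shift (Suc k) (\<Phi> a u)) \<le> CARD('n) - 1"
      using degree_poly_shift_le[of "Suc k" "\<Phi> a u"] degree_le_n[OF u, of a] by linarith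
  qed simp
  then have \<psi>0: "\<psi> a = 0" for a
    using irr rel unfolding reduces_to_def by blast
  obtain a where "coeff (\<Phi> a u) CARD('n) \<noteq> 0"
    using reduces_to_lead_0[OF u] irr by blast
  then show ?thesis
    using poly_shift_combination_eq_0[OF \<psi>0[of a, unfolded \<psi>_def] degree_le_n[OF u] _ k] by blast
qed

end

section \<open>From the compatibility condition to quasilinear equations\<close>

theorem proposition1:
  fixes s1 s2 :: complex and s :: "'n::finite \<Rightarrow> complex"
    and \<Omega> :: "(complex \<times> (complex ^ 'n)) set"
    and U :: "(complex ^ 'n) set"
    and W F G H :: "complex \<Rightarrow> complex ^ 'n \<Rightarrow> complex"
    and \<phi> \<phi>1 \<phi>2 :: "complex ^ 'n \<Rightarrow> complex poly"
  assumes n_ge_2: "CARD('n) \<ge> 2"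
    and domain: "admissible_domain \<Omega>"
    and U_def: "U = snd ` \<Omega>"
    and W: "W_branch s1 s2 s \<Omega> W"
    and sol: "solves_L s1 s2 s U \<phi>"
    and sol1: "solves_L s1 s2 s U \<phi>1"
    and sol2: "solves_L s1 s2 s U \<phi>2"
    and indep: "lin_indep3 U \<phi> \<phi>1 \<phi>2"
    and nondeg: "nondegenerate s1 s2 s U {\<phi>, \<phi>1, \<phi>2}"
    and F: "potential_of \<Omega> W \<phi> F"
    and G: "potential_of \<Omega> W \<phi>1 G"
    and H: "potential_of \<Omega> W \<phi>2 H"
  shows "\<exists>a b c :: 'n \<Rightarrow> 'n \<Rightarrow> complex ^ 'n \<Rightarrow> complex.
           independent_quasilinear_system U a b c \<and> pseudopotential \<Omega> F G H a b c"
proof -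
  define \<Phi> :: "3 \<Rightarrow> complex ^ 'n \<Rightarrow> complex poly"
    where "\<Phi> a = (if a = 1 then \<phi> else if a = 2 then \<phi>1 else \<phi>2)" for a
  have \<Phi>: "\<Phi> 1 = \<phi>" "\<Phi> 2 = \<phi>1" "\<Phi> 3 = \<phi>2" by (simp_all add: \<Phi>_def)
  have op: "open \<Omega>" and con: "connected \<Omega>"
    and dom: "\<And>\<zeta> u. (\<zeta>, u) \<in> \<Omega> \<Longrightarrow> inj (\<lambda>i. u $ i) \<and> (\<forall>i. u $ i \<noteq> 0 \<and> u $ i \<noteq> 1) \<and>
        \<zeta> \<noteq> 0 \<and> \<zeta> \<noteq> 1 \<and> (\<forall>i. \<zeta> \<noteq> u $ i)"
    using domain unfolding admissible_domain_def by auto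
  \<comment> \<open>Over an empty set every combination vanishes, which contradicts
    independence.\<close>
  have ne: "U \<noteq> {}"
  proof
    assume "U = {}"
    then show False using indep unfolding lin_indep3_def by (metis empty_iff one_neq_zero)
  qed
  interpret linear_system s1 s2 s U \<Phi>
  proof
    show "open U" unfolding U_def by (rule open_image_snd[OF op])
    show "connected U" unfolding U_def by (intro connected_continuous_image con continuous_intros)
    show "U \<noteq> {}" by (rule ne)
    show "inj (\<lambda>i. u $ i)" "u $ i \<noteq> 0" "u $ i \<noteq> 1" if "u \<in> U" for u i
      using that dom unfolding U_def by auto
    show "solves_L s1 s2 s U (\<Phi> a)" for a by (simp add: \<Phi>_def sol sol1 sol2)
    show "\<exists>a b :: 3. a \<noteq> b" by (intro exI[of _ 1] exI[of _ 2]) simp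
    show "nondegenerate s1 s2 s U (range \<Phi>)"
      using nondeg \<Phi> by (simp add: UNIV_3)
    fix c :: "3 \<Rightarrow> complex" and a
    assume z: "\<And>u. u \<in> U \<Longrightarrow> (\<Sum>b\<in>UNIV. smult (c b) (\<Phi> b u)) = 0"
    have "c 1 = 0 \<and> c 2 = 0 \<and> c 3 = 0"
      using indep z unfolding lin_indep3_def by (simp add: sum_3 \<Phi>) blast
    then show "c a = 0" using forall_3[of "\<lambda>a. c a = 0"] by simp
  qed
  \<comment> \<open>Equation \<open>i\<close> is to be the coefficient of the power with exponent
    \<open>e i\<close>; the exponents run from 0 to \<open>CARD('n) - 1\<close>.\<close>
  obtain e :: "'n \<Rightarrow> nat" where e: "bij_betw e UNIV {0..<CARD('n)}"
    using ex_bij_betw_finite_nat[of "UNIV :: 'n set"] by auto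
  have sum_e: "(\<Sum>i\<in>UNIV. f (e i)) = (\<Sum>k<CARD('n). f k)" for f :: "nat \<Rightarrow> complex"
    using sum.reindex_bij_betw[OF e, of f] by (simp add: atLeast0LessThan)
  define q where "q a b k j u = poly (bez (\<Phi> a u) (\<Phi> b u) k) (u $ j) / D j u" for a b k j u
  define A where "A i j u = q 2 3 (e i) j u" for i j u
  define B where "B i j u = q 3 1 (e i) j u" for i j u
  define C where "C i j u = q 1 2 (e i) j u" for i j u
  define V where "V = {u \<in> U. \<not> reduces_to (CARD('n) - 1) (\<lambda>a. \<Phi> a u)}"
  have "independent_equations_at A B C u" if "u \<in> V" for u
    unfolding independent_equations_at_def
  proof (intro allI impI)
    fix r :: "'n \<Rightarrow> complex" and i
    assume z: "\<forall>j. (\<Sum>i\<in>UNIV. r i * A i j u) = 0 \<and> (\<Sum>i\<in>UNIV. r i * B i j u) = 0 \<and> (\<Sum>i\<in>UNIV. r i * C i j u) = 0"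
    define \<rho> where "\<rho> k = r (inv e k)" for k
    have r: "r i = \<rho> (e i)" for i
      using e unfolding \<rho>_def bij_betw_def by simp
    have uU: "u \<in> U" using that by (simp add: V_def)
    let ?Z = "\<lambda>a b. \<forall>j. (\<Sum>k<CARD('n). \<rho> k * poly (bez (\<Phi> a u) (\<Phi> b u) k) (u $ j)) = 0"
    have q: "(\<Sum>i\<in>UNIV. r i * q a b (e i) j u) = (\<Sum>k<CARD('n). \<rho> k * poly (bez (\<Phi> a u) (\<Phi> b u) k) (u $ j)) / D j u" for a b j
      unfolding r sum_e[of "\<lambda>k. \<rho> k * q a b k j u"] by (simp add: q_def sum_divide_distrib)
    have Z: "?Z 2 3" "?Z 3 1" "?Z 1 2"
      using z D_neq_0[OF uU] unfolding A_def B_def C_def q by auto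
    \<comment> \<open>The Bezoutian is alternating, so the three cyclic pairs account for all
      pairs.\<close>
    have swap: "?Z b a" if "?Z a b" for a b
    proof -
      have "bez (\<Phi> b u) (\<Phi> a u) k = - bez (\<Phi> a u) (\<Phi> b u) k" for k by (simp add: bez_def)
      then show ?thesis using that by (simp add: sum_negf)
    qed
    have diag: "?Z a a" for a by (simp add: bez_def)
    have "?Z a b" for a b
    proof -
      have "\<forall>a b. ?Z a b" unfolding forall_3 using Z swap[OF Z(1)] swap[OF Z(2)] swap[OF Z(3)] diag by simp
      then show ?thesis by blast
    qed
    moreover have "e i < CARD('n)" using e unfolding bij_betw_def by auto
    ultimately show "r i = 0"
      unfolding r using that bez_coefficients_independent[OF uU, of \<rho> "e i"] unfolding V_def by blast
  qed
  moreover have "open V" unfolding V_def by (rule open_irreducible)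
  moreover have "V \<subseteq> U" by (auto simp: V_def)
  moreover have "U \<subseteq> closure V"
  proof
    fix u assume u: "u \<in> U"
    show "u \<in> closure V"
      unfolding closure_iff_nhds_not_empty
    proof (intro allI impI)
      fix X S assume "S \<subseteq> X" "open S" "u \<in> S"
      then have "\<exists>v\<in>S \<inter> U. \<not> reduces_to (CARD('n) - 1) (\<lambda>a. \<Phi> a v)"
        using u open_U by (intro exists_irreducible) auto
      then show "V \<inter> X \<noteq> {}" using \<open>S \<subseteq> X\<close> by (auto simp: V_def)
    qed
  qed
  ultimately have "independent_quasilinear_system U A B C"
    unfolding independent_quasilinear_system_def
    by (auto simp: A_def[abs_def] B_def[abs_def] C_def[abs_def] q_def intro!: holomorphic_bez)
  moreover have "pseudopotential \<Omega> F G H A B C"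
    unfolding pseudopotential_def
  proof (intro allI impI)
    fix X :: "(complex ^ 3) set" and u :: "complex ^ 3 \<Rightarrow> complex ^ 'n"
    assume "open X \<and> (\<forall>i. holomorphic_vec (\<lambda>p. u p $ i) X) \<and> u ` X \<subseteq> snd ` \<Omega>"
    then have uX: "u p \<in> U" if "p \<in> X" for p using that U_def by blast
    \<comment> \<open>The derivatives of \<open>u\<close> enter linearly as numbers, so the
      equivalence is proved at each point for arbitrary \<open>x\<close>, \<open>y\<close>,
      \<open>t\<close> in their place.\<close>
    have pointwise: "(\<forall>\<zeta>. (\<zeta>, u p) \<in> \<Omega> \<longrightarrow>
        (let F\<zeta> = deriv (\<lambda>z. F z (u p)) \<zeta>; Fu = (\<lambda>i. partial_deriv i (F \<zeta>) (u p));
             G\<zeta> = deriv (\<lambda>z. G z (u p)) \<zeta>; Gu = (\<lambda>i. partial_deriv i (G \<zeta>) (u p));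
             H\<zeta> = deriv (\<lambda>z. H z (u p)) \<zeta>; Hu = (\<lambda>i. partial_deriv i (H \<zeta>) (u p))
         in (\<Sum>i\<in>UNIV. (H\<zeta> * Gu i - G\<zeta> * Hu i) * y i)
          + (\<Sum>i\<in>UNIV. (F\<zeta> * Hu i - H\<zeta> * Fu i) * t i)
          + (\<Sum>i\<in>UNIV. (G\<zeta> * Fu i - F\<zeta> * Gu i) * x i) = 0)) \<longleftrightarrow>
       (\<forall>i. (\<Sum>j\<in>UNIV. A i j (u p) * y j) + (\<Sum>j\<in>UNIV. B i j (u p) * t j)
              + (\<Sum>j\<in>UNIV. C i j (u p) * x j) = 0)" (is "?lhs \<longleftrightarrow> ?rhs")
      if p: "p \<in> X" for p and x y t :: "'n \<Rightarrow> complex"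
    proof -
      define v where "v = u p"
      have vU: "v \<in> U" using uX[OF p] by (simp add: v_def)
      define E where "E k = (\<Sum>j\<in>UNIV. q 2 3 k j v * y j) + (\<Sum>j\<in>UNIV. q 3 1 k j v * t j)
              + (\<Sum>j\<in>UNIV. q 1 2 k j v * x j)" for k
      \<comment> \<open>One bracket of the compatibility condition. The minus sign in the
        derivatives by \<open>u $ j\<close> reverses the pair to \<open>q b a\<close>, and the
        factor \<open>\<zeta> - v $ j\<close> of the Bezoutian identity completes
        \<open>P j \<zeta> v\<close>, so the prefactor does not depend on \<open>j\<close>.\<close>
      have minor: "(poly (\<Phi> a v) \<zeta> / W \<zeta> v) * (- (poly (\<Phi> b v) (v $ j) / D j v) * (P j \<zeta> v / W \<zeta> v))
          - (poly (\<Phi> b v) \<zeta> / W \<zeta> v) * (- (poly (\<Phi> a v) (v $ j) / D j v) * (P j \<zeta> v / W \<zeta> v))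
          = \<zeta> * (\<zeta> - 1) * poly (nodal_poly v) \<zeta> / (W \<zeta> v)\<^sup>2 * (\<Sum>k<CARD('n). q b a k j v * \<zeta> ^ k)" for a b j \<zeta>
      proof -
        have "(poly (\<Phi> a v) \<zeta> / W \<zeta> v) * (- (poly (\<Phi> b v) (v $ j) / D j v) * (P j \<zeta> v / W \<zeta> v))
          - (poly (\<Phi> b v) \<zeta> / W \<zeta> v) * (- (poly (\<Phi> a v) (v $ j) / D j v) * (P j \<zeta> v / W \<zeta> v))
          = (poly (\<Phi> b v) \<zeta> * poly (\<Phi> a v) (v $ j) - poly (\<Phi> a v) \<zeta> * poly (\<Phi> b v) (v $ j)) *
            P j \<zeta> v / (D j v * (W \<zeta> v)\<^sup>2)"
          by (simp add: power2_eq_square diff_divide_distrib algebra_simps)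
        also have "\<dots> = ((\<zeta> - v $ j) * P j \<zeta> v) / (W \<zeta> v)\<^sup>2 *
            ((\<Sum>k<CARD('n). poly (bez (\<Phi> b v) (\<Phi> a v) k) (v $ j) * \<zeta> ^ k) / D j v)"
          unfolding bez_expansion[OF degree_le_n[OF vU] degree_le_n[OF vU]]
          by (simp add: mult_ac)
        also have "(\<zeta> - v $ j) * P j \<zeta> v = \<zeta> * (\<zeta> - 1) * poly (nodal_poly v) \<zeta>"
          by (simp add: poly_nodal_poly P_def prod.remove[of UNIV j] algebra_simps)
        also have "(\<Sum>k<CARD('n). poly (bez (\<Phi> b v) (\<Phi> a v) k) (v $ j) * \<zeta> ^ k) / D j v = (\<Sum>k<CARD('n). q b a k j v * \<zeta> ^ k)"
          by (simp add: q_def sum_divide_distrib)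
        finally show ?thesis .
      qed
      have sum_minor: "(\<Sum>i\<in>UNIV. (M * (\<Sum>k<CARD('n). q a b k i v * \<zeta> ^ k)) * w i) =
         M * (\<Sum>k<CARD('n). (\<Sum>j\<in>UNIV. q a b k j v * w j) * \<zeta> ^ k)" for M a b \<zeta> and w :: "'n \<Rightarrow> complex"
      proof -
        have "(\<Sum>i\<in>UNIV. (M * (\<Sum>k<CARD('n). q a b k i v * \<zeta> ^ k)) * w i) =
          (\<Sum>i\<in>UNIV. \<Sum>k<CARD('n). M * (q a b k i v * w i * \<zeta> ^ k))"
          by (simp add: sum_distrib_left sum_distrib_right mult_ac)
        also have "\<dots> = (\<Sum>k<CARD('n). \<Sum>i\<in>UNIV. M * (q a b k i v * w i * \<zeta> ^ k))"
          by (rule sum.swap)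
        finally show ?thesis by (simp add: sum_distrib_left sum_distrib_right)
      qed
      define M where "M \<zeta> = \<zeta> * (\<zeta> - 1) * poly (nodal_poly v) \<zeta> / (W \<zeta> v)\<^sup>2" for \<zeta>
      \<comment> \<open>\<open>W\<close> is a product of exponentials, and points of
        \<open>\<Omega>\<close> avoid the zeros of the other factors.\<close>
      have M0: "M \<zeta> \<noteq> 0" if "(\<zeta>, v) \<in> \<Omega>" for \<zeta>
      proof -
        have "W \<zeta> v \<noteq> 0" using W that unfolding W_branch_def by fastforce
        then show ?thesis using dom[OF that] by (auto simp: M_def poly_nodal_poly)
      qed
      have lhs: "?lhs \<longleftrightarrow> (\<forall>\<zeta>. (\<zeta>, v) \<in> \<Omega> \<longrightarrow> M \<zeta> * (\<Sum>k<CARD('n). E k * \<zeta> ^ k) = 0)"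
        unfolding v_def[symmetric]
      proof (intro iff_allI imp_cong refl)
        fix \<zeta> assume z: "(\<zeta>, v) \<in> \<Omega>"
        have pot: "deriv (\<lambda>z. F z v) \<zeta> = poly (\<Phi> 1 v) \<zeta> / W \<zeta> v"
          "\<And>i. partial_deriv i (F \<zeta>) v = - (poly (\<Phi> 1 v) (v $ i) / D i v) * (P i \<zeta> v / W \<zeta> v)"
          "deriv (\<lambda>z. G z v) \<zeta> = poly (\<Phi> 2 v) \<zeta> / W \<zeta> v"
          "\<And>i. partial_deriv i (G \<zeta>) v = - (poly (\<Phi> 2 v) (v $ i) / D i v) * (P i \<zeta> v / W \<zeta> v)"
          "deriv (\<lambda>z. H z v) \<zeta> = poly (\<Phi> 3 v) \<zeta> / W \<zeta> v"
          "\<And>i. partial_deriv i (H \<zeta>) v = - (poly (\<Phi> 3 v) (v $ i) / D i v) * (P i \<zeta> v / W \<zeta> v)"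
          using F G H z unfolding potential_of_def \<Phi> by auto
        have "M \<zeta> * (\<Sum>k<CARD('n). E k * \<zeta> ^ k) =
           M \<zeta> * (\<Sum>k<CARD('n). (\<Sum>j\<in>UNIV. q 2 3 k j v * y j) * \<zeta> ^ k)
           + M \<zeta> * (\<Sum>k<CARD('n). (\<Sum>j\<in>UNIV. q 3 1 k j v * t j) * \<zeta> ^ k)
           + M \<zeta> * (\<Sum>k<CARD('n). (\<Sum>j\<in>UNIV. q 1 2 k j v * x j) * \<zeta> ^ k)"
          by (simp add: E_def distrib_right sum.distrib distrib_left)
        then show "(let F\<zeta> = deriv (\<lambda>z. F z v) \<zeta>; Fu = (\<lambda>i. partial_deriv i (F \<zeta>) v);
             G\<zeta> = deriv (\<lambda>z. G z v) \<zeta>; Gu = (\<lambda>i. partial_deriv i (G \<zeta>) v);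
             H\<zeta> = deriv (\<lambda>z. H z v) \<zeta>; Hu = (\<lambda>i. partial_deriv i (H \<zeta>) v)
         in (\<Sum>i\<in>UNIV. (H\<zeta> * Gu i - G\<zeta> * Hu i) * y i)
          + (\<Sum>i\<in>UNIV. (F\<zeta> * Hu i - H\<zeta> * Fu i) * t i)
          + (\<Sum>i\<in>UNIV. (G\<zeta> * Fu i - F\<zeta> * Gu i) * x i) = 0) \<longleftrightarrow> M \<zeta> * (\<Sum>k<CARD('n). E k * \<zeta> ^ k) = 0"
          unfolding Let_def pot minor M_def[symmetric] sum_minor by simp
      qed
      obtain \<zeta>0 where \<zeta>0: "(\<zeta>0, v) \<in> \<Omega>" using vU unfolding U_def by auto
      \<comment> \<open>The admissible values of the parameter form a nonempty open set, hence an
        infinite one, so a polynomial vanishing there has zero coefficients.\<close>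
      have slice: "open {\<zeta>. (\<zeta>, v) \<in> \<Omega>}"
        using open_vimage[OF op, of "\<lambda>\<zeta>. (\<zeta>, v)"] by (simp add: vimage_def continuous_on_Pair)
      have "?lhs \<longleftrightarrow> (\<forall>k<CARD('n). E k = 0)"
      proof
        assume ?lhs
        then have z: "(\<Sum>k<CARD('n). E k * \<zeta> ^ k) = 0" if "(\<zeta>, v) \<in> \<Omega>" for \<zeta>
          using M0 that unfolding lhs by auto
        define R where "R = (\<Sum>k<CARD('n). monom (E k) k)"
        have "R = 0"
        proof (rule ccontr)
          assume "R \<noteq> 0"
          then have "finite {\<zeta>. poly R \<zeta> = 0}" by (rule poly_roots_finite)
          moreover have "{\<zeta>. (\<zeta>, v) \<in> \<Omega>} \<subseteq> {\<zeta>. poly R \<zeta> = 0}"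
            using z by (auto simp: R_def poly_sum poly_monom)
          ultimately have "finite {\<zeta>. (\<zeta>, v) \<in> \<Omega>}" by (rule rev_finite_subset)
          then have "{\<zeta>. (\<zeta>, v) \<in> \<Omega>} = {}" using slice finite_imp_not_open by blast
          then show False using \<zeta>0 by blast
        qed
        moreover have "coeff R k = E k" if "k < CARD('n)" for k
          using that by (simp add: R_def coeff_sum)
        ultimately show "\<forall>k<CARD('n). E k = 0" by simp
      next
        assume "\<forall>k<CARD('n). E k = 0"
        then show ?lhs unfolding lhs by simp
      qed
      also have "\<dots> \<longleftrightarrow> ?rhs"
      proof -
        have "(\<forall>k<CARD('n). E k = 0) \<longleftrightarrow> (\<forall>i. E (e i) = 0)"
          using e unfolding bij_betw_def by (auto simp: set_eq_iff image_iff) metis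
        then show ?thesis by (simp add: E_def A_def B_def C_def v_def)
      qed
      finally show ?thesis .
    qed
    show "compatible \<Omega> F G H X u \<longleftrightarrow> solves_quasilinear A B C X u"
      unfolding compatible_def solves_quasilinear_def by (intro ball_cong refl pointwise)
  qed
  ultimately show ?thesis by blast
qed

end
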